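(* Let $m,n\geq 1$ be integers with $m\geq n$. There is a group isomorphism $\mathfrak{mod}(A_{n,m})\cong\mathfrak{mod}^*(A_{n,m-n+1})$.
   Context: Tree and surfaces. For integers $n,m\geq 1$, $A_{n,m}$ is the infinite locally finite planar tree having one vertex (the central vertex) of valence $m$ while all other vertices have valence $n+1$. $\mathscr{S}(A_{n,m})$ is the oriented planar surface with boundary obtained by embedding $A_{n,m}$ in the plane and thickening it. $\mathscr{S}^\sharp(A_{n,m})$ is obtained from it by adding one puncture for each vertex of the tree; $\mathscr{S}^*(A_{n,m})$ is obtained by adding one puncture for each vertex except the central one. Each carries a fixed rigid structure: a family of pairwise disjoint arcs with endpoints on the boundary of the surface, each arc crossing a unique edge of the tree, once and transversely, dividing the surface into regions called polygons, each containing exactly one vertex of the tree in its interior. (So every polygon contains exactly one puncture, except the central polygon of $\mathscr{S}^*(A_{n,m})$, which contains none.) Groups. An admissible surface is a connected (in particular nonempty) subsurface that is a finite union of polygons. An asymptotically rigid homeomorphism of $\mathscr{S}^\sharp(A_{n,m})$ (resp. $\mathscr{S}^*(A_{n,m})$) is a homeomorphism $\phi$ of that surface to itself for which there is an admissible surface whose image under $\phi$ is admissible and outside which $\phi$ sends polygons to polygons. $\mathfrak{mod}(A_{n,m})$ (resp. $\mathfrak{mod}^*(A_{n,m})$) is the group of isotopy classes of orientation-preserving asymptotically rigid homeomorphisms of $\mathscr{S}^\sharp(A_{n,m})$ (resp. $\mathscr{S}^*(A_{n,m})$). *)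

theory Defs
  imports "HOL-Complex_Analysis.Winding_Numbers" "HOL-Algebra.Group"
begin

section \<open>The tree\<close>

text \<open>
  The tree \<open>A\<^bsub>n,m\<^esub>\<close> is rooted at its central vertex, and a vertex is the word of
  child indices leading to it from the root: the root has \<open>m\<close> children and no parent, every
  other vertex has \<open>n\<close> children and one parent.
\<close>

definition tree_vertices :: "nat \<Rightarrow> nat \<Rightarrow> nat list set" where
  "tree_vertices n m = {v. v = [] \<or> hd v < m \<and> set (tl v) \<subseteq> {..<n}}"

definition adjacent :: "nat list \<Rightarrow> nat list \<Rightarrow> bool" where
  "adjacent u v \<longleftrightarrow> (\<exists>i. v = u @ [i] \<or> u = v @ [i])"

lemma Nil_in_tree_vertices [simp]: "[] \<in> tree_vertices n m"
  by (simp add: tree_vertices_def)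

lemma Cons_in_tree_vertices [simp]:
  "i # w \<in> tree_vertices n m \<longleftrightarrow> i < m \<and> w \<in> tree_vertices n n"
  by (cases w) (auto simp: tree_vertices_def)

lemma snoc_in_tree_vertices:
  "v @ [i] \<in> tree_vertices n m \<longleftrightarrow> v \<in> tree_vertices n m \<and> i < (if v = [] then m else n)"
  by (induction v arbitrary: m) auto

lemma valence:
  assumes "v \<in> tree_vertices n m"
  shows "card {u \<in> tree_vertices n m. adjacent v u} = (if v = [] then m else n + 1)"
proof (cases "v = []")
  case True
  have "{u \<in> tree_vertices n m. adjacent v u} = (\<lambda>i. [i]) ` {..<m}"
    using True by (auto simp: adjacent_def)
  then show ?thesis using True by (simp add: card_image inj_on_def)
next
  case False
  have "{u \<in> tree_vertices n m. adjacent v u} = insert (butlast v) ((\<lambda>i. v @ [i]) ` {..<n})"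
    using False assms snoc_in_tree_vertices[of "butlast v" "last v" n m]
    by (auto simp: adjacent_def snoc_in_tree_vertices) (metis append_butlast_last_id)
  moreover have "butlast v \<notin> (\<lambda>i. v @ [i]) ` {..<n}"
    by (auto dest: arg_cong[of _ _ length])
  ultimately show ?thesis using False by (simp add: card_image inj_on_def)
qed


section \<open>The thickened tree and its rigid structure\<close>

text \<open>
  The tree is drawn in the closed upper half-plane, a vertex of depth \<open>d\<close> lying at height
  \<open>d + 1/2\<close>, and thickened to a union of rectangles (the cells). The cell of a vertex of
  depth \<open>d\<close> occupies the heights between \<open>d\<close> and \<open>d + 1\<close>, and on its top side it carries
  the bottom sides of the cells of its children, which are pairwise disjoint segments avoiding the
  two top corners. These bottom sides (for the vertices other than the root) are the arcs of the
  rigid structure.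

  The affine map \<open>slot k i\<close> sends the unit interval onto the part of it used by the
  \<open>i\<close>-th of \<open>k\<close> children.
\<close>

definition slot :: "nat \<Rightarrow> nat \<Rightarrow> real \<Rightarrow> real" where
  "slot k i x = (2 * real i + 1 + x) / (2 * real k + 1)"

fun place :: "nat \<Rightarrow> nat \<Rightarrow> nat list \<Rightarrow> real \<Rightarrow> real" where
  "place n m [] x = x"
| "place n m (i # w) x = slot m i (place n n w x)"

definition vertex_point :: "nat \<Rightarrow> nat \<Rightarrow> nat list \<Rightarrow> complex" where
  "vertex_point n m v = Complex (place n m v (1/2)) (real (length v) + 1/2)"

definition cell :: "nat \<Rightarrow> nat \<Rightarrow> nat list \<Rightarrow> complex set" where
  "cell n m v = {z. Re z \<in> place n m v ` {0..1} \<and> Im z \<in> {real (length v)..real (length v) + 1}}"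

definition rigid_arc :: "nat \<Rightarrow> nat \<Rightarrow> nat list \<Rightarrow> complex set" where
  "rigid_arc n m v = {z. Re z \<in> place n m v ` {0..1} \<and> Im z = real (length v)}"

text \<open>
  The edge joining a vertex \<open>v\<close> other than the root to its parent is a broken line through
  the midpoint of the arc between the two cells.
\<close>

definition tree_edge :: "nat \<Rightarrow> nat \<Rightarrow> nat list \<Rightarrow> complex set" where
  "tree_edge n m v =
     (let p = Complex (place n m v (1/2)) (real (length v))
      in closed_segment (vertex_point n m (butlast v)) p \<union> closed_segment p (vertex_point n m v))"

text \<open>
  A puncture is a removed point. The set \<open>Q\<close> is the set of vertices whose cell is punctured.
\<close>

definition surface :: "nat \<Rightarrow> nat \<Rightarrow> nat list set \<Rightarrow> complex set" where
  "surface n m Q = (\<Union>v\<in>tree_vertices n m. cell n m v) - vertex_point n m ` Q"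

definition polygon :: "nat \<Rightarrow> nat \<Rightarrow> nat list set \<Rightarrow> nat list \<Rightarrow> complex set" where
  "polygon n m Q v = cell n m v - vertex_point n m ` Q"

lemma slot_eq_iff [simp]: "slot k i x = slot k i y \<longleftrightarrow> x = y"
  by (simp add: slot_def divide_simps)

lemma slot_bounds: "i < k \<Longrightarrow> x \<in> {0..1} \<Longrightarrow> slot k i x \<in> {0<..<1}"
  by (simp add: slot_def divide_simps)

lemma slot_disjoint:
  assumes "slot k i x = slot k j y" "x \<in> {0..1}" "y \<in> {0..1}"
  shows "i = j"
proof -
  have e: "2 * real i + x = 2 * real j + y"
    using assms(1) by (simp add: slot_def divide_simps)
  then have "real i < real j + 1" "real j < real i + 1"
    using assms(2,3) by (auto simp only: atLeastAtMost_iff)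
  then show ?thesis by linarith
qed

lemma place_bounds:
  "v \<in> tree_vertices n m \<Longrightarrow> x \<in> {0..1} \<Longrightarrow> place n m v x \<in> {0..1}"
proof (induction v arbitrary: m)
  case (Cons i w)
  then have "place n n w x \<in> {0..1}" by (metis Cons_in_tree_vertices)
  moreover have "i < m" using Cons.prems by simp
  ultimately have "slot m i (place n n w x) \<in> {0<..<1}" by (rule slot_bounds[rotated])
  then show ?case by simp
qed simp

definition lift :: "nat \<Rightarrow> nat \<Rightarrow> complex \<Rightarrow> complex" where
  "lift m i z = Complex (slot m i (Re z)) (Im z + 1)"

lemma inj_lift: "inj (lift m i)"
  by (auto simp: lift_def inj_def complex_eq_iff)

lemma cell_Cons: "cell n m (i # w) = lift m i ` cell n n w"
proof -
  have "z \<in> lift m i ` cell n n w" if z: "z \<in> cell n m (i # w)" for z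
  proof -
    obtain x where x: "x \<in> {0..1}" "Re z = slot m i (place n n w x)"
      using z by (auto simp: cell_def simp del: atLeastAtMost_iff)
    have "Complex (place n n w x) (Im z - 1) \<in> cell n n w"
      using z x by (auto simp: cell_def)
    moreover have "lift m i (Complex (place n n w x) (Im z - 1)) = z"
      using x by (simp add: lift_def complex_eq_iff)
    ultimately show ?thesis by (metis imageI)
  qed
  then show ?thesis by (auto simp: cell_def lift_def)
qed

lemma rigid_arc_Cons: "rigid_arc n m (i # w) = lift m i ` rigid_arc n n w"
proof -
  have "z \<in> lift m i ` rigid_arc n n w" if z: "z \<in> rigid_arc n m (i # w)" for z
  proof -
    obtain x where x: "x \<in> {0..1}" "Re z = slot m i (place n n w x)"
      using z by (auto simp: rigid_arc_def simp del: atLeastAtMost_iff)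
    have "Complex (place n n w x) (Im z - 1) \<in> rigid_arc n n w"
      using z x by (auto simp: rigid_arc_def)
    moreover have "lift m i (Complex (place n n w x) (Im z - 1)) = z"
      using x by (simp add: lift_def complex_eq_iff)
    ultimately show ?thesis by (metis imageI)
  qed
  then show ?thesis by (auto simp: rigid_arc_def lift_def)
qed

lemma cell_root_Int:
  assumes "v \<in> tree_vertices n m" "v \<noteq> []"
  shows "cell n m [] \<inter> cell n m v = (if adjacent [] v then rigid_arc n m v else {})"
proof -
  obtain i w where v: "v = i # w" using assms by (cases v) auto
  have sub: "place n m v ` {0..1} \<subseteq> {0..1}"
    using place_bounds[OF assms(1)] by blast
  have root: "cell n m [] = {z. Re z \<in> {0..1} \<and> Im z \<in> {0..1}}"
    by (simp add: cell_def image_def)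
  show ?thesis
  proof (cases "w = []")
    case True
    have "cell n m [] \<inter> cell n m v = rigid_arc n m v"
      unfolding root using sub by (auto simp: cell_def rigid_arc_def v True)
    then show ?thesis by (simp add: adjacent_def v True)
  next
    case False
    then have "1 < real (length v)" by (cases w) (auto simp: v)
    then have "cell n m [] \<inter> cell n m v = {}"
      unfolding root cell_def by auto
    then show ?thesis using False by (simp add: adjacent_def v)
  qed
qed

lemma cell_Int:
  assumes "u \<in> tree_vertices n m" "v \<in> tree_vertices n m" "u \<noteq> v" "length u \<le> length v"
  shows "cell n m u \<inter> cell n m v = (if adjacent u v then rigid_arc n m v else {})"
  using assms
proof (induction u arbitrary: v m)
  case Nil
  then show ?case using cell_root_Int by auto
next
  case (Cons i u)
  obtain j w where v: "v = j # w" using Cons.prems by (cases v) auto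
  show ?case
  proof (cases "i = j")
    case True
    have "cell n n u \<inter> cell n n w = (if adjacent u w then rigid_arc n n w else {})"
      using Cons.prems True v by (intro Cons.IH) auto
    moreover have "adjacent (i # u) v \<longleftrightarrow> adjacent u w"
      by (auto simp: adjacent_def v True)
    ultimately show ?thesis
      using True v by (simp add: cell_Cons rigid_arc_Cons image_Int[OF inj_lift, symmetric])
  next
    case False
    have "cell n m (i # u) \<inter> cell n m v = {}"
    proof (rule ccontr)
      assume "cell n m (i # u) \<inter> cell n m v \<noteq> {}"
      then obtain z where "z \<in> cell n m (i # u)" "z \<in> cell n m v" by blast
      then obtain x y where xy: "x \<in> {0..1}" "y \<in> {0..1}"
          "slot m i (place n n u x) = slot m j (place n n w y)"
        unfolding cell_def v by (smt (verit) imageE mem_Collect_eq place.simps(2))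
      have "place n n u x \<in> {0..1}" "place n n w y \<in> {0..1}"
        using xy Cons.prems v by (auto intro!: place_bounds simp del: atLeastAtMost_iff)
      then show False using slot_disjoint[OF xy(3)] False by blast
    qed
    moreover have "\<not> adjacent (i # u) v"
      using False Cons.prems by (auto simp: adjacent_def v)
    ultimately show ?thesis by simp
  qed
qed

lemma rigid_arc_disjoint:
  assumes "u \<in> tree_vertices n m" "v \<in> tree_vertices n m" "u \<noteq> v"
  shows "rigid_arc n m u \<inter> rigid_arc n m v = {}"
proof (cases "length u = length v")
  case True
  have "rigid_arc n m u \<inter> rigid_arc n m v \<subseteq> cell n m u \<inter> cell n m v"
    by (auto simp: rigid_arc_def cell_def)
  moreover have "\<not> adjacent u v" using True by (auto simp: adjacent_def)
  ultimately show ?thesis using cell_Int[OF assms] True by simp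
qed (auto simp: rigid_arc_def)

lemma tree_edge_Int_rigid_arc:
  assumes "u \<in> tree_vertices n m" "v \<in> tree_vertices n m" "u \<noteq> []" "v \<noteq> []"
  shows "tree_edge n m u \<inter> rigid_arc n m v =
           (if u = v then {Complex (place n m v (1/2)) (real (length v))} else {})"
proof -
  define p where "p = Complex (place n m u (1/2)) (real (length u))"
  have p: "p \<in> rigid_arc n m u"
    by (auto simp: p_def rigid_arc_def)
  have len: "real (length (butlast u)) = real (length u) - 1"
    using assms by (cases u rule: rev_cases) auto
  have ends: "Im (vertex_point n m (butlast u)) = Im p - 1/2" "Im (vertex_point n m u) = Im p + 1/2"
    "Im p = real (length u)"
    using len by (simp_all add: p_def vertex_point_def del: length_butlast)
  have seg: "z = p" if z: "z \<in> closed_segment p a" and im: "Im z = real l" "\<bar>Im a - Im p\<bar> = 1/2" for z a l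
  proof -
    obtain t where t: "0 \<le> t" "t \<le> 1" "z = (1 - t) *\<^sub>R p + t *\<^sub>R a"
      using z by (auto simp: closed_segment_def)
    have "Im z - Im p = t * (Im a - Im p)"
      unfolding t(3) by (simp add: algebra_simps)
    then have *: "\<bar>real l - real (length u)\<bar> = t * (1/2)"
      using im t(1) ends(3) by (simp add: abs_mult)
    have "\<bar>real l - real (length u)\<bar> < 1" unfolding * using t by simp
    then have "l = length u" by linarith
    with * have "t = 0" by simp
    with t show ?thesis by simp
  qed
  have "z = p" if "z \<in> tree_edge n m u" "Im z = real l" for z l
  proof -
    have "z \<in> closed_segment p (vertex_point n m (butlast u)) \<or> z \<in> closed_segment p (vertex_point n m u)"
      using that(1) by (simp add: tree_edge_def Let_def p_def closed_segment_commute)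
    then show ?thesis
      by (elim disjE; elim seg) (use that(2) ends in auto)
  qed
  then have sub: "tree_edge n m u \<inter> rigid_arc n m v \<subseteq> {p}"
    by (auto simp: rigid_arc_def)
  show ?thesis
  proof (cases "u = v")
    case True
    have "p \<in> tree_edge n m u" by (simp add: tree_edge_def Let_def p_def)
    then have "tree_edge n m u \<inter> rigid_arc n m v = {p}" using sub p True by blast
    then show ?thesis using True by (simp add: p_def)
  next
    case False
    then have "p \<notin> rigid_arc n m v" using p rigid_arc_disjoint[OF assms(1,2)] by blast
    then have "tree_edge n m u \<inter> rigid_arc n m v = {}" using sub by blast
    then show ?thesis using False by simp
  qed
qed

lemma vertex_point_in_cell_iff:
  assumes "u \<in> tree_vertices n m" "v \<in> tree_vertices n m"
  shows "vertex_point n m u \<in> cell n m v \<longleftrightarrow> u = v"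
proof
  have u: "vertex_point n m u \<in> cell n m u" for u
    by (auto simp: vertex_point_def cell_def)
  then show "vertex_point n m u \<in> cell n m v" if "u = v" using that by blast
  assume "vertex_point n m u \<in> cell n m v"
  then have "real (length v) \<le> real (length u) + 1/2" "real (length u) + 1/2 \<le> real (length v) + 1"
    by (auto simp: vertex_point_def cell_def)
  then have l: "length u = length v" by linarith
  then have "\<not> adjacent u v" by (auto simp: adjacent_def)
  then show "u = v"
    using cell_Int[OF assms _ eq_imp_le[OF l]] u[of u] \<open>vertex_point n m u \<in> cell n m v\<close>
    by (metis IntI empty_iff)
qed


section \<open>Asymptotically rigid mapping class groups\<close>

definition admissible :: "nat \<Rightarrow> nat \<Rightarrow> nat list set \<Rightarrow> complex set \<Rightarrow> bool" where
  "admissible n m Q \<Sigma> \<longleftrightarrow>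
     connected \<Sigma> \<and>
     (\<exists>V. finite V \<and> V \<noteq> {} \<and> V \<subseteq> tree_vertices n m \<and> \<Sigma> = (\<Union>v\<in>V. polygon n m Q v))"

text \<open>
  A homeomorphism between planar surfaces preserves the standard orientation of the plane if it
  sends every positively oriented circle bounding a disc in the surface to a curve winding once,
  positively, around the image of the centre (it has local degree one).
\<close>

definition orientation_preserving_on :: "complex set \<Rightarrow> (complex \<Rightarrow> complex) \<Rightarrow> bool" where
  "orientation_preserving_on S f \<longleftrightarrow>
     (\<forall>z r. 0 < r \<and> cball z r \<subseteq> S \<longrightarrow> winding_number (f \<circ> circlepath z r) (f z) = 1)"

abbreviation self_homeomorphism :: "complex set \<Rightarrow> (complex \<Rightarrow> complex) \<Rightarrow> bool" where
  "self_homeomorphism S f \<equiv> homeomorphic_map (top_of_set S) (top_of_set S) f"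

text \<open>
  Homeomorphisms are represented by functions on the whole plane, whose values off the surface
  are arbitrary. Functions that agree on the surface are isotopic in the sense below, so passing
  to isotopy classes also removes this ambiguity.
\<close>

definition asymp_rigid_homeos :: "nat \<Rightarrow> nat \<Rightarrow> nat list set \<Rightarrow> (complex \<Rightarrow> complex) set" where
  "asymp_rigid_homeos n m Q =
     {f. self_homeomorphism (surface n m Q) f \<and>
         orientation_preserving_on (surface n m Q) f \<and>
         (\<exists>\<Sigma>. admissible n m Q \<Sigma> \<and> admissible n m Q (f ` \<Sigma>) \<and>
              (\<forall>v\<in>tree_vertices n m. \<not> polygon n m Q v \<subseteq> \<Sigma> \<longrightarrow>
                 f ` polygon n m Q v \<in> polygon n m Q ` tree_vertices n m))}"

text \<open>
  An isotopy is a homotopy through homeomorphisms of the surface; the intermediate homeomorphisms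
  need not be asymptotically rigid, nor fix the boundary pointwise.
\<close>

definition isotopy_rel ::
    "nat \<Rightarrow> nat \<Rightarrow> nat list set \<Rightarrow> ((complex \<Rightarrow> complex) \<times> (complex \<Rightarrow> complex)) set" where
  "isotopy_rel n m Q =
     {(f, g). f \<in> asymp_rigid_homeos n m Q \<and> g \<in> asymp_rigid_homeos n m Q \<and>
        homotopic_with (self_homeomorphism (surface n m Q))
          (top_of_set (surface n m Q)) (top_of_set (surface n m Q)) f g}"

definition mapping_class_group :: "nat \<Rightarrow> nat \<Rightarrow> nat list set \<Rightarrow> (complex \<Rightarrow> complex) set monoid" where
  "mapping_class_group n m Q =
     \<lparr>carrier = asymp_rigid_homeos n m Q // isotopy_rel n m Q,
      mult = (\<lambda>A B. \<Union>f\<in>A. \<Union>g\<in>B. isotopy_rel n m Q `` {f \<circ> g}),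
      one = isotopy_rel n m Q `` {id}\<rparr>"

text \<open>
  \<open>amod n m\<close> is the group for the surface with one puncture for each vertex, and
  \<open>amod_star n m\<close> the group for the surface with no puncture at the central vertex.
\<close>

definition amod :: "nat \<Rightarrow> nat \<Rightarrow> (complex \<Rightarrow> complex) set monoid" where
  "amod n m = mapping_class_group n m (tree_vertices n m)"

definition amod_star :: "nat \<Rightarrow> nat \<Rightarrow> (complex \<Rightarrow> complex) set monoid" where
  "amod_star n m = mapping_class_group n m (tree_vertices n m - {[]})"

lemma homotopic_self_homeomorphism_cong:
  assumes "self_homeomorphism S f" "\<And>z. z \<in> S \<Longrightarrow> f z = g z"
  shows "homotopic_with (self_homeomorphism S) (top_of_set S) (top_of_set S) f g"
proof (rule homotopic_with_equal)
  show "continuous_map (top_of_set S) (top_of_set S) f"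
    using assms(1) by (rule homeomorphic_imp_continuous_map)
  show "self_homeomorphism S f" by fact
  show "self_homeomorphism S g"
    using assms(1) by (rule homeomorphic_map_eq) (simp add: assms(2))
  show "f z = g z" if "z \<in> topspace (top_of_set S)" for z
    using that assms(2) by simp
qed

end

theory Submission
  imports Defs "HOL-Complex_Analysis.Riemann_Mapping"
begin

text \<open>
  Merge the central polygon of the surface of \<open>A\<^bsub>n,m-n+1\<^esub>\<close>, which is not punctured, with one
  of its neighbours: the union is a disc with one puncture and \<open>(m - n) + n = m\<close> arcs on its
  boundary, so that it looks like the central polygon of the surface of \<open>A\<^bsub>n,m\<^esub>\<close>. This
  yields a homeomorphism between the two punctured surfaces that sends polygons to polygons, except
  for the central polygon, whose image is the union of two polygons. As an admissible surface can be
  enlarged without affecting asymptotic rigidity, conjugation by this homeomorphism identifies the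
  two groups.

  The homeomorphism is the restriction of an injective map of the plane, composed of maps that are
  increasing on each horizontal or each vertical line; such maps have local degree one.
\<close>

section \<open>Local degree\<close>

text \<open>Two features of the definitions shape the proof. Admissible surfaces are connected, and
  connectedness is awkward to carry through composites, inverses and the passage between two
  different trees. It is traded for a combinatorial condition, \<open>almost_rigid\<close>, and
  recovered afterwards: the vertices up to a given depth span a connected surface, and every finite
  set of vertices lies in such a set. Orientation is tested on round circles only, whose images are
  no longer round, so the degree has to be shown multiplicative for continuous injective maps. Even
  the explicit map needs this, since monotonicity in the sense of \<open>plane_monotone\<close> is
  lost under composition. That map is built so that on the whole strip above an arc it merely
  exchanges one \<open>lift\<close> for another, or for two. Infinitely many polygons are then
  treated at once, and all genuine deformation takes place in the central cells and in the gaps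
  between slots.\<close>

lemma homotopic_loops_circlepath:
  assumes "path p" "pathfinish p = pathstart p" "path_image p \<subseteq> cball w r - {w}"
    and "winding_number p w = 1" "0 < r"
  shows "homotopic_loops (cball w r - {w}) p (circlepath w r)"
proof -
  \<comment> \<open>Winding number one gives a homotopy to the circle in the plane minus
    \<open>w\<close> only. The radial map \<open>\<rho>\<close> pushes it into the punctured disc:
    outer points are pulled to the boundary circle, points of the disc stay.\<close>
  define c where "c z = min 1 (r / cmod (z - w))" for z
  define \<rho> where "\<rho> z = w + complex_of_real (c z) * (z - w)" for z
  have \<rho>_id: "\<rho> z = z" if "z \<in> cball w r - {w}" for z
  proof -
    have "1 \<le> r / cmod (z - w)" using that
      by (auto simp: dist_norm norm_minus_commute)
    then show ?thesis by (simp add: \<rho>_def c_def min_def)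
  qed
  have "w \<notin> path_image p" using assms(3) by blast
  then have "homotopic_loops (- {w}) p (circlepath w r)"
    using assms winding_number_circlepath_centre[of r w]
    by (subst winding_number_homotopic_loops_eq[symmetric]) auto
  moreover have "continuous_on (- {w}) \<rho>"
    unfolding \<rho>_def c_def by (intro continuous_intros) auto
  moreover have "\<rho> \<in> - {w} \<rightarrow> cball w r - {w}"
  proof
    fix z assume z: "z \<in> - {w}"
    then have pos: "0 < cmod (z - w)" by simp
    have c: "0 < c z" using assms(5) pos by (simp add: c_def)
    then have "cmod (\<rho> z - w) = c z * cmod (z - w)"
      by (simp add: \<rho>_def norm_mult)
    also have "\<dots> \<le> (r / cmod (z - w)) * cmod (z - w)"
      by (intro mult_right_mono) (auto simp: c_def)
    also have "\<dots> = r" using pos by simp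
    finally have "cmod (\<rho> z - w) \<le> r" .
    moreover have "\<rho> z \<noteq> w" using pos c by (simp add: \<rho>_def)
    ultimately show "\<rho> z \<in> cball w r - {w}" by (simp add: dist_norm norm_minus_commute)
  qed
  ultimately have hom: "homotopic_loops (cball w r - {w}) (\<rho> \<circ> p) (\<rho> \<circ> circlepath w r)"
    by (rule homotopic_loops_continuous_image)
  have id: "homotopic_loops (cball w r - {w}) q (\<rho> \<circ> q)"
    if "path q" "pathfinish q = pathstart q" "path_image q \<subseteq> cball w r - {w}" for q
    using that by (intro homotopic_loops_eq) (auto simp: path_image_def \<rho>_id image_subset_iff)
  have "path_image (circlepath w r) \<subseteq> cball w r - {w}"
    using assms(5) by (auto simp: dist_norm norm_minus_commute)
  then have "homotopic_loops (cball w r - {w}) (circlepath w r) (\<rho> \<circ> circlepath w r)"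
    by (intro id) auto
  then show ?thesis
    using id[of p] hom assms by (meson homotopic_loops_sym homotopic_loops_trans)
qed

lemma winding_number_comp_homotopic:
  assumes "homotopic_loops (D - {w}) p q" "continuous_on D f" "inj_on f D" "w \<in> D"
  shows "winding_number (f \<circ> p) (f w) = winding_number (f \<circ> q) (f w)"
proof (rule winding_number_homotopic_loops, rule homotopic_loops_continuous_image[OF assms(1)])
  show "continuous_on (D - {w}) f" using assms(2) by (rule continuous_on_subset) auto
  show "f \<in> D - {w} \<rightarrow> - {f w}" using assms(3,4) by (auto dest: inj_onD)
qed

lemma loop_in_punctured_image:
  assumes "continuous_on D f" "inj_on f D" "0 < s" "cball z s \<subseteq> D" "f ` cball z s \<subseteq> E"
  shows "path (f \<circ> circlepath z s)" "pathfinish (f \<circ> circlepath z s) = pathstart (f \<circ> circlepath z s)"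
    "path_image (f \<circ> circlepath z s) \<subseteq> E - {f z}"
proof -
  have sub: "path_image (circlepath z s) \<subseteq> cball z s - {z}"
    using assms(3) by (auto simp: dist_norm norm_minus_commute)
  show "path (f \<circ> circlepath z s)"
    by (rule path_continuous_image)
      (use sub assms(4) in \<open>auto intro!: continuous_on_subset[OF assms(1)]\<close>)
  show "pathfinish (f \<circ> circlepath z s) = pathstart (f \<circ> circlepath z s)"
    by (simp add: pathfinish_compose pathstart_compose)
  have "f u \<in> E - {f z}" if u: "u \<in> path_image (circlepath z s)" for u
  proof -
    have u': "u \<in> cball z s" "u \<noteq> z" using u sub by auto
    moreover have "u \<in> D" "z \<in> D" using u'(1) assms(3,4) by auto
    ultimately have "f u \<noteq> f z" using inj_onD[OF assms(2)] by metis
    then show ?thesis using assms(5) u'(1) by auto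
  qed
  then show "path_image (f \<circ> circlepath z s) \<subseteq> E - {f z}"
    by (simp add: path_image_compose image_subset_iff)
qed

text \<open>The hypothesis on \<open>g\<close> speaks of round circles, and \<open>f\<close> does
  not produce any. Invariance of domain places a round disc around \<open>f z\<close> inside the
  image, and \<open>f\<close> maps a small circle around \<open>z\<close> into it; in the punctured
  disc this image is homotopic to a round circle, to which \<open>g\<close> applies.\<close>

lemma orientation_preserving_on_comp:
  assumes f: "continuous_on S f" "inj_on f S" "f ` S \<subseteq> T" "orientation_preserving_on S f"
    and g: "continuous_on T g" "inj_on g T" "orientation_preserving_on T g"
  shows "orientation_preserving_on S (g \<circ> f)"
  unfolding orientation_preserving_on_def
proof (intro allI impI, elim conjE)
  fix z and r :: real assume r: "0 < r" "cball z r \<subseteq> S"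
  have ball: "ball z r \<subseteq> S" using r ball_subset_cball by blast
  have "open (f ` ball z r)"
    using ball f by (intro invariance_of_domain) (auto intro: continuous_on_subset inj_on_subset)
  moreover have "f z \<in> f ` ball z r" using r by simp
  ultimately obtain e where e: "0 < e" "cball (f z) e \<subseteq> f ` ball z r"
    by (meson open_contains_cball)
  then have eT: "cball (f z) e \<subseteq> T" using ball f(3) by blast
  have "continuous_on (ball z r) f" using f(1) ball by (rule continuous_on_subset)
  then have "isCont f z" using r by (simp add: continuous_on_eq_continuous_at)
  then obtain d where d: "0 < d" "\<And>u. dist u z < d \<Longrightarrow> dist (f u) (f z) < e"
    using e(1) unfolding continuous_at by (metis LIM_def dist_self)
  define s where "s = min (d / 2) (r / 2)"
  have s: "0 < s" "s < d" "s < r" using d r by (auto simp: s_def min_def)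
  have sr: "cball z s \<subseteq> cball z r" using s by auto
  have sS: "cball z s \<subseteq> S" using sr r by blast
  have fs: "f ` cball z s \<subseteq> cball (f z) e"
  proof (clarsimp)
    fix u assume "dist z u \<le> s"
    then have "dist (f u) (f z) < e" using s d(2)[of u] by (simp add: dist_commute)
    then show "dist (f z) (f u) \<le> e" by (simp add: dist_commute)
  qed
  \<comment> \<open>The small and the given circle have the same winding number after applying
    \<open>g \<circ> f\<close>, which is injective on the larger disc.\<close>
  have "path_image (circlepath z s) \<subseteq> cball z r - {z}"
    using s by (auto simp: dist_norm norm_minus_commute)
  then have "homotopic_loops (cball z r - {z}) (circlepath z s) (circlepath z r)"
    using s r winding_number_circlepath_centre[of s z] by (intro homotopic_loops_circlepath) auto
  moreover have "continuous_on (cball z r) (g \<circ> f)"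
    using f g r(2) by (intro continuous_on_compose) (auto intro: continuous_on_subset)
  moreover have "inj_on (g \<circ> f) (cball z r)"
    using f g r(2) by (intro comp_inj_on) (auto intro: inj_on_subset)
  ultimately have 1: "winding_number (g \<circ> f \<circ> circlepath z s) ((g \<circ> f) z)
      = winding_number (g \<circ> f \<circ> circlepath z r) ((g \<circ> f) z)"
    using r by (intro winding_number_comp_homotopic) auto
  have "winding_number (f \<circ> circlepath z s) (f z) = 1"
    using f(4) s(1) sS by (auto simp: orientation_preserving_on_def)
  then have "homotopic_loops (cball (f z) e - {f z}) (f \<circ> circlepath z s) (circlepath (f z) e)"
    using loop_in_punctured_image[OF f(1,2) s(1) sS fs] e(1)
    by (intro homotopic_loops_circlepath) auto
  then have "winding_number (g \<circ> (f \<circ> circlepath z s)) (g (f z))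
      = winding_number (g \<circ> circlepath (f z) e) (g (f z))"
    using g eT e(1)
    by (intro winding_number_comp_homotopic[where D = "cball (f z) e"])
      (auto intro: continuous_on_subset inj_on_subset)
  also have "\<dots> = 1"
    using g(3) e(1) eT by (auto simp: orientation_preserving_on_def)
  finally show "winding_number (g \<circ> f \<circ> circlepath z r) ((g \<circ> f) z) = 1"
    using 1 by (simp add: comp_assoc)
qed

text \<open>A small circle around \<open>g w\<close> has an \<open>f\<close>-image of winding number
  one, hence homotopic to the given circle in the punctured disc around \<open>w\<close>. Applying
  \<open>g\<close> turns this image back into the small round circle.\<close>

lemma orientation_preserving_on_inverse:
  assumes f: "continuous_on S f" "inj_on f S" "orientation_preserving_on S f"
    and g: "continuous_on T g" "inj_on g T" "g ` T \<subseteq> S" "\<And>y. y \<in> T \<Longrightarrow> f (g y) = y"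
  shows "orientation_preserving_on T g"
  unfolding orientation_preserving_on_def
proof (intro allI impI, elim conjE)
  fix w and r :: real assume r: "0 < r" "cball w r \<subseteq> T"
  have ball: "ball w r \<subseteq> T" using r ball_subset_cball by blast
  have "open (g ` ball w r)"
    using ball g by (intro invariance_of_domain) (auto intro: continuous_on_subset inj_on_subset)
  moreover have "g w \<in> g ` ball w r" using r by simp
  ultimately obtain e where e: "0 < e" "cball (g w) e \<subseteq> g ` ball w r"
    by (meson open_contains_cball)
  have eS: "cball (g w) e \<subseteq> S" using e ball g(3) by blast
  have fg: "f (g w) = w" using r by (intro g(4)) auto
  have "f ` cball (g w) e \<subseteq> f ` g ` ball w r" using e(2) by blast
  also have "\<dots> \<subseteq> cball w r" using g(4) ball by auto
  finally have fe: "f ` cball (g w) e \<subseteq> cball w r" .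
  have "winding_number (f \<circ> circlepath (g w) e) (f (g w)) = 1"
    using f(3) e(1) eS by (auto simp: orientation_preserving_on_def)
  then have "homotopic_loops (cball w r - {w}) (f \<circ> circlepath (g w) e) (circlepath w r)"
    using loop_in_punctured_image[OF f(1,2) e(1) eS fe] r(1) unfolding fg
    by (intro homotopic_loops_circlepath)
  then have *: "winding_number (g \<circ> (f \<circ> circlepath (g w) e)) (g w) = winding_number (g \<circ> circlepath w r) (g w)"
    using g r
    by (intro winding_number_comp_homotopic[where D = "cball w r"])
      (auto intro: continuous_on_subset inj_on_subset)
  have gf: "g (f u) = u" if u: "u \<in> cball (g w) e" for u
  proof -
    obtain v where "v \<in> ball w r" "u = g v" using u e(2) by blast
    then show ?thesis using g(4) ball by auto
  qed
  have "(g \<circ> (f \<circ> circlepath (g w) e)) t = circlepath (g w) e t" if "t \<in> {0..1}" for t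
    using that e(1) unfolding o_def
    by (intro gf) (auto simp: circlepath dist_norm norm_mult)
  then have "winding_number (g \<circ> (f \<circ> circlepath (g w) e)) (g w) = winding_number (circlepath (g w) e) (g w)"
    using e(1) loop_in_punctured_image[OF f(1,2) e(1) eS fe]
    by (intro winding_number_homotopic_loops homotopic_loops_sym[OF homotopic_loops_eq])
       (auto simp: dist_norm)
  then show "winding_number (g \<circ> circlepath w r) (g w) = 1"
    using * e(1) by (simp add: winding_number_circlepath_centre)
qed

lemma orientation_preserving_on_id: "orientation_preserving_on S id"
  by (simp add: orientation_preserving_on_def winding_number_circlepath_centre)

lemma orientation_preserving_on_subset:
  "orientation_preserving_on T f \<Longrightarrow> S \<subseteq> T \<Longrightarrow> orientation_preserving_on S f"
  unfolding orientation_preserving_on_def by blast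


section \<open>Maps that are rigid outside finitely many polygons\<close>

text \<open>The exceptional unions are merely finite, and the two index sets may differ: this makes
  the condition stable under composition and inversion and meaningful between different surfaces.
  The bijection records that the remaining polygons are exhausted on both sides.\<close>

definition almost_rigid ::
    "'a set \<Rightarrow> ('a \<Rightarrow> 'c set) \<Rightarrow> 'b set \<Rightarrow> ('b \<Rightarrow> 'd set) \<Rightarrow> ('c \<Rightarrow> 'd) \<Rightarrow> bool" where
  "almost_rigid V P W R f \<longleftrightarrow>
     (\<exists>A B \<sigma>. finite A \<and> A \<subseteq> V \<and> finite B \<and> B \<subseteq> W \<and> f ` \<Union>(P ` A) = \<Union>(R ` B) \<and>
        bij_betw \<sigma> (V - A) (W - B) \<and> (\<forall>v\<in>V - A. f ` P v = R (\<sigma> v)))"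

lemma almost_rigidE:
  assumes "almost_rigid V P W R f"
  obtains A B \<sigma> where "finite A" "A \<subseteq> V" "finite B" "B \<subseteq> W" "f ` \<Union>(P ` A) = \<Union>(R ` B)"
    "bij_betw \<sigma> (V - A) (W - B)" "\<forall>v\<in>V - A. f ` P v = R (\<sigma> v)"
  using assms unfolding almost_rigid_def by (elim exE conjE) (rule that)

lemma image_Union_family:
  "(\<And>v. v \<in> C \<Longrightarrow> f ` P v = R (\<sigma> v)) \<Longrightarrow> f ` \<Union>(P ` C) = \<Union>(R ` \<sigma> ` C)"
  unfolding image_UN image_image by (rule SUP_cong) simp_all

lemma almost_rigid_image:
  assumes "almost_rigid V P W R f"
  shows "f ` \<Union>(P ` V) = \<Union>(R ` W)"
proof -
  obtain A B \<sigma> where *: "A \<subseteq> V" "B \<subseteq> W" "f ` \<Union>(P ` A) = \<Union>(R ` B)"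
    "bij_betw \<sigma> (V - A) (W - B)" "\<forall>v\<in>V - A. f ` P v = R (\<sigma> v)"
    using assms by (rule almost_rigidE)
  have "f ` \<Union>(P ` (V - A)) = \<Union>(R ` \<sigma> ` (V - A))"
    using *(5) by (intro image_Union_family) blast
  then have "f ` \<Union>(P ` (V - A)) = \<Union>(R ` (W - B))"
    using *(4) by (simp only: bij_betw_def)
  moreover have "\<Union>(P ` V) = \<Union>(P ` A) \<union> \<Union>(P ` (V - A))"
    "\<Union>(R ` W) = \<Union>(R ` B) \<union> \<Union>(R ` (W - B))"
    using *(1,2) by blast+
  ultimately show ?thesis using *(3) by (simp only: image_Un)
qed

text \<open>The freedom to enlarge the exceptional set serves twice: it makes two maps composable,
  and it lets a finite set be replaced by one with a connected union.\<close>

lemma rigid_outside_larger_set: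
  assumes "f ` \<Union>(P ` A) = \<Union>(R ` B)" "B \<subseteq> W" "bij_betw \<sigma> (V - A) (W - B)"
    and "\<forall>v\<in>V - A. f ` P v = R (\<sigma> v)" "A \<subseteq> A'" "A' \<subseteq> V"
  shows "f ` \<Union>(P ` A') = \<Union>(R ` (B \<union> \<sigma> ` (A' - A)))"
    and "B \<union> \<sigma> ` (A' - A) \<subseteq> W"
    and "bij_betw \<sigma> (V - A') (W - (B \<union> \<sigma> ` (A' - A)))"
proof -
  have A': "A \<union> (A' - A) = A'" using assms(5) by blast
  have "f ` \<Union>(P ` (A \<union> (A' - A))) = f ` \<Union>(P ` A) \<union> f ` \<Union>(P ` (A' - A))"
    by (simp only: image_Un Union_Un_distrib)
  then have "f ` \<Union>(P ` A') = f ` \<Union>(P ` A) \<union> f ` \<Union>(P ` (A' - A))"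
    unfolding A' .
  moreover have "f ` \<Union>(P ` (A' - A)) = \<Union>(R ` \<sigma> ` (A' - A))"
    using assms(4,6) by (intro image_Union_family) blast
  ultimately show "f ` \<Union>(P ` A') = \<Union>(R ` (B \<union> \<sigma> ` (A' - A)))"
    using assms(1) by simp
  show "B \<union> \<sigma> ` (A' - A) \<subseteq> W"
    using assms(2,3,6) by (auto simp: bij_betw_def)
  have "bij_betw \<sigma> (V - A') (\<sigma> ` (V - A'))"
    using assms(3,5) by (auto intro!: inj_on_imp_bij_betw intro: inj_on_subset simp: bij_betw_def)
  moreover have "V - A' = (V - A) - (A' - A)" using assms(5) by blast
  then have "\<sigma> ` (V - A') = \<sigma> ` (V - A) - \<sigma> ` (A' - A)"
    using assms(3,6) by (metis Diff_mono bij_betw_def inj_on_image_set_diff order_refl Diff_subset)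
  then have "\<sigma> ` (V - A') = W - (B \<union> \<sigma> ` (A' - A))"
    using assms(3) by (auto simp: bij_betw_def)
  ultimately show "bij_betw \<sigma> (V - A') (W - (B \<union> \<sigma> ` (A' - A)))" by simp
qed

lemma almost_rigid_comp:
  assumes f: "almost_rigid V P W R f" and g: "almost_rigid W R X T g"
  shows "almost_rigid V P X T (g \<circ> f)"
proof -
  obtain A B \<sigma> where A: "finite A" "A \<subseteq> V" "finite B" "B \<subseteq> W" "f ` \<Union>(P ` A) = \<Union>(R ` B)"
    "bij_betw \<sigma> (V - A) (W - B)" "\<forall>v\<in>V - A. f ` P v = R (\<sigma> v)"
    using f by (rule almost_rigidE)
  obtain C D \<tau> where C: "finite C" "C \<subseteq> W" "finite D" "D \<subseteq> X" "g ` \<Union>(R ` C) = \<Union>(T ` D)"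
    "bij_betw \<tau> (W - C) (X - D)" "\<forall>v\<in>W - C. g ` R v = T (\<tau> v)"
    using g by (rule almost_rigidE)
  \<comment> \<open>Both exceptional sets grow until they meet in the middle: \<open>f\<close>
    carries \<open>A'\<close> onto \<open>B \<union> C\<close>, and \<open>g\<close> starts from
    there.\<close>
  define A' where "A' = A \<union> {v \<in> V - A. \<sigma> v \<in> C}"
  define D' where "D' = D \<union> \<tau> ` (B \<union> C - C)"
  have \<sigma>A': "B \<union> \<sigma> ` (A' - A) = B \<union> C"
    using A(6) C(2) by (auto simp: A'_def bij_betw_def)
  have "finite {v \<in> V - A. \<sigma> v \<in> C}"
    using C(1) A(6) finite_vimage_IntI[of C \<sigma> "V - A"]
    by (auto simp: bij_betw_def vimage_def Int_def conj_commute)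
  then have fin: "finite A'" "finite D'" using A(1,3) C(1,3) by (auto simp: A'_def D'_def)
  have sub: "A \<subseteq> A'" "A' \<subseteq> V" using A(2) by (auto simp: A'_def)
  note f' = rigid_outside_larger_set[OF A(5,4,6,7) sub, unfolded \<sigma>A']
  have "B \<union> C \<subseteq> W" using A(4) C(2) by blast
  note g' = rigid_outside_larger_set[OF C(5,4,6,7) _ this, folded D'_def]
  have "(g \<circ> f) ` \<Union>(P ` A') = \<Union>(T ` D')"
    using f'(1) g'(1) by (simp only: image_comp[symmetric] Un_upper2)
  moreover have "bij_betw (\<tau> \<circ> \<sigma>) (V - A') (X - D')"
    using f'(3) g'(3) by (auto intro: bij_betw_trans)
  moreover have "(g \<circ> f) ` P v = T ((\<tau> \<circ> \<sigma>) v)" if v: "v \<in> V - A'" for v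
  proof -
    have "\<sigma> v \<in> W - (B \<union> C)" using f'(3) v by (auto simp: bij_betw_def)
    then have "g ` R (\<sigma> v) = T (\<tau> (\<sigma> v))" using C(7) by blast
    moreover have "f ` P v = R (\<sigma> v)" using A(7) v sub by blast
    ultimately show ?thesis by (simp only: image_comp[symmetric] o_apply)
  qed
  ultimately show ?thesis
    unfolding almost_rigid_def using fin sub g'(2)
    by (intro exI[of _ A'] exI[of _ D'] exI[of _ "\<tau> \<circ> \<sigma>"]) simp
qed

lemma almost_rigid_inverse:
  assumes f: "almost_rigid V P W R f" and g: "\<And>x. x \<in> \<Union>(P ` V) \<Longrightarrow> g (f x) = x"
  shows "almost_rigid W R V P g"
proof -
  obtain A B \<sigma> where A: "finite A" "A \<subseteq> V" "finite B" "B \<subseteq> W" "f ` \<Union>(P ` A) = \<Union>(R ` B)"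
    "bij_betw \<sigma> (V - A) (W - B)" "\<forall>v\<in>V - A. f ` P v = R (\<sigma> v)"
    using f by (rule almost_rigidE)
  have gf: "g ` f ` E = E" if "E \<subseteq> \<Union>(P ` V)" for E
    using that g by force
  define \<tau> where "\<tau> = inv_into (V - A) \<sigma>"
  have "bij_betw \<tau> (W - B) (V - A)" using A(6) by (simp add: \<tau>_def bij_betw_inv_into)
  moreover have "g ` \<Union>(R ` B) = \<Union>(P ` A)"
    unfolding A(5)[symmetric] by (rule gf) (use A(2) in auto)
  moreover have "g ` R w = P (\<tau> w)" if w: "w \<in> W - B" for w
  proof -
    have t: "\<tau> w \<in> V - A" "\<sigma> (\<tau> w) = w"
      using A(6) w calculation(1) bij_betwE by (auto simp: \<tau>_def bij_betw_inv_into_right)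
    then have "R w = f ` P (\<tau> w)" using A(7) by metis
    then show ?thesis using t by (simp only:) (intro gf, auto)
  qed
  ultimately show ?thesis unfolding almost_rigid_def
    using A(1-4) by (intro exI[of _ B] exI[of _ A] exI[of _ \<tau>]) simp
qed

lemma almost_rigid_id: "almost_rigid V P V P id"
  unfolding almost_rigid_def by (intro exI[of _ "{}"] exI[of _ id]) auto


section \<open>Polygons\<close>

lemma place_affine: "\<exists>a c. 0 < c \<and> (\<forall>x. place n m v x = a + c * x)"
proof (induction v arbitrary: m)
  case Nil
  show ?case by (intro exI[of _ 0] exI[of _ 1]) simp
next
  case (Cons i v)
  then obtain a c where "0 < c" "\<forall>x. place n n v x = a + c * x" by blast
  then show ?case
    by (intro exI[of _ "(2 * real i + 1 + a) / (2 * real m + 1)"] exI[of _ "c / (2 * real m + 1)"])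
      (simp add: slot_def add_divide_distrib)
qed

text \<open>A convex set that is not collinear stays connected when countably many points are
  removed; having interior points excludes the collinear case for a cell.\<close>

lemma connected_polygon: "connected (polygon n m Q v)"
proof -
  obtain a c where ac: "0 < c" "\<And>x. place n m v x = a + c * x" using place_affine by blast
  have "place n m v ` {0..1} = (\<lambda>x. c * x + a) ` {0..1}"
    by (intro image_cong) (simp_all add: ac(2))
  also have "\<dots> = {a..a + c}"
    using image_affinity_atLeastAtMost[of c a 0 1] ac(1) by (simp add: add.commute)
  finally have cell: "cell n m v = cbox (Complex a (real (length v))) (Complex (a + c) (real (length v) + 1))"
    by (auto simp: cell_def in_cbox_complex_iff)
  have "Complex (a + c / 2) (real (length v) + 1 / 2) \<in> interior (cell n m v)"
    using ac(1) unfolding cell interior_cbox by (simp add: in_box_complex_iff)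
  then have "aff_dim (cell n m v) = 2"
    using aff_dim_nonempty_interior[of "cell n m v"] by auto
  then have "\<not> collinear (cell n m v)" by (simp add: collinear_aff_dim)
  then show ?thesis
    unfolding polygon_def cell by (intro connected_convex_diff_countable) auto
qed

text \<open>Punctures lie at half-integer heights and arcs at integer ones. A quarter above the
  bottom side both are avoided, so this point belongs to a single polygon and identifies it,
  whatever the set of punctures.\<close>

definition inner_point :: "nat \<Rightarrow> nat \<Rightarrow> nat list \<Rightarrow> complex" where
  "inner_point n m v = Complex (place n m v (1/2)) (real (length v) + 1/4)"

lemma inner_point_in_polygon_iff:
  assumes "u \<in> tree_vertices n m" "v \<in> tree_vertices n m"
  shows "inner_point n m u \<in> polygon n m Q v \<longleftrightarrow> u = v"
proof
  have "real (length w) + 1/2 \<noteq> real (length u) + 1/4" for w :: "nat list"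
  proof
    assume "real (length w) + 1/2 = real (length u) + 1/4"
    then have "4 * length w + 1 = 4 * length u" by linarith
    then show False by presburger
  qed
  then have "Im (inner_point n m u) \<noteq> Im (vertex_point n m w)" for w
    unfolding inner_point_def vertex_point_def complex.sel by metis
  then have "inner_point n m u \<notin> vertex_point n m ` Q" by (metis imageE)
  moreover have u: "inner_point n m u \<in> cell n m u"
    by (auto simp: inner_point_def cell_def)
  ultimately show "inner_point n m u \<in> polygon n m Q v" if "u = v"
    using that by (simp add: polygon_def)
  assume "inner_point n m u \<in> polygon n m Q v"
  then have v: "inner_point n m u \<in> cell n m v" by (simp add: polygon_def)
  then have "real (length v) \<le> real (length u) + 1/4" "real (length u) + 1/4 \<le> real (length v) + 1"
    by (auto simp: inner_point_def cell_def)
  then have l: "length u = length v" by linarith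
  then have "\<not> adjacent u v" by (auto simp: adjacent_def)
  then show "u = v"
    using cell_Int[OF assms _ eq_imp_le[OF l]] u v by (metis IntI empty_iff)
qed

lemma polygon_subset_Union_iff:
  assumes "v \<in> tree_vertices n m" "A \<subseteq> tree_vertices n m"
  shows "polygon n m Q v \<subseteq> \<Union>(polygon n m Q ` A) \<longleftrightarrow> v \<in> A"
proof
  assume "polygon n m Q v \<subseteq> \<Union>(polygon n m Q ` A)"
  then obtain u where "u \<in> A" "inner_point n m v \<in> polygon n m Q u"
    using inner_point_in_polygon_iff[OF assms(1) assms(1)] by blast
  then show "v \<in> A" using inner_point_in_polygon_iff[OF assms(1), of u] assms(2) by auto
qed blast

lemma Union_polygon: "\<Union>(polygon n m Q ` tree_vertices n m) = surface n m Q"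
  by (auto simp: polygon_def surface_def)

text \<open>The common arc lies at an integer height, so no puncture touches it and it survives in
  both polygons.\<close>

lemma polygon_Int_child:
  assumes "v @ [i] \<in> tree_vertices n m"
  shows "polygon n m Q v \<inter> polygon n m Q (v @ [i]) \<noteq> {}"
proof -
  define z where "z = Complex (place n m (v @ [i]) (1/2)) (real (length (v @ [i])))"
  have "v \<in> tree_vertices n m" using assms snoc_in_tree_vertices by blast
  then have "cell n m v \<inter> cell n m (v @ [i]) = rigid_arc n m (v @ [i])"
    using assms by (subst cell_Int) (auto simp: adjacent_def)
  moreover have "z \<in> rigid_arc n m (v @ [i])" by (auto simp: z_def rigid_arc_def)
  moreover have "real (length w) + 1/2 \<noteq> real (length (v @ [i]))" for w :: "nat list"
  proof
    assume "real (length w) + 1/2 = real (length (v @ [i]))"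
    then have "2 * length w + 1 = 2 * length (v @ [i])" by linarith
    then show False by presburger
  qed
  then have "Im z \<noteq> Im (vertex_point n m w)" for w
    unfolding z_def vertex_point_def complex.sel by metis
  then have "z \<notin> vertex_point n m ` Q" by (metis imageE)
  ultimately show ?thesis by (auto simp: polygon_def)
qed

section \<open>Connected unions of polygons along subtrees\<close>

lemma take_in_tree_vertices: "v \<in> tree_vertices n m \<Longrightarrow> take i v \<in> tree_vertices n m"
  by (induction v arbitrary: i m) (auto simp: take_Cons split: nat.split)

lemma connected_branch:
  "v \<in> tree_vertices n m \<Longrightarrow> connected (\<Union>i\<le>length v. polygon n m Q (take i v))"
proof (induction v rule: rev_induct)
  case Nil
  then show ?case by (simp add: connected_polygon)
next
  case (snoc i v)
  have "v \<in> tree_vertices n m" using snoc.prems snoc_in_tree_vertices by blast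
  then have "connected ((\<Union>j\<le>length v. polygon n m Q (take j v)) \<union> polygon n m Q (v @ [i]))"
    using snoc.IH polygon_Int_child[OF snoc.prems, of Q]
    by (intro connected_Un connected_polygon) force+
  moreover have "(\<Union>j\<le>length (v @ [i]). polygon n m Q (take j (v @ [i])))
      = (\<Union>j\<le>length v. polygon n m Q (take j v)) \<union> polygon n m Q (v @ [i])"
    by (auto simp: atMost_Suc)
  ultimately show ?case by simp
qed

text \<open>All branches contain the root polygon, so their union is connected. These surfaces are
  cofinal among the finite unions of polygons, which is how an arbitrary finite exceptional set is
  made admissible.\<close>

lemma admissible_bounded_depth:
  "admissible n m Q (\<Union>(polygon n m Q ` {v \<in> tree_vertices n m. length v \<le> N}))"
  (is "admissible n m Q (\<Union>(?P ` ?A))")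
proof -
  have "\<Union>(?P ` ?A) = \<Union>((\<lambda>v. \<Union>i\<le>length v. ?P (take i v)) ` ?A)" (is "_ = \<Union>?B")
  proof
    show "\<Union>(?P ` ?A) \<subseteq> \<Union>?B" by force
    show "\<Union>?B \<subseteq> \<Union>(?P ` ?A)" using take_in_tree_vertices by fastforce
  qed
  moreover have "connected (\<Union>?B)"
  proof (rule connected_Union)
    show "connected s" if "s \<in> ?B" for s using that connected_branch by auto
    have "inner_point n m [] \<in> ?P (take 0 v)" for v
      by (simp add: inner_point_in_polygon_iff)
    then have "inner_point n m [] \<in> \<Inter>?B" by blast
    then show "\<Inter>?B \<noteq> {}" by blast
  qed
  moreover have "set v \<subseteq> {..<max m n}" if "v \<in> tree_vertices n m" for v
    using that by (cases v) (auto simp: tree_vertices_def)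
  then have "?A \<subseteq> {v. set v \<subseteq> {..<max m n} \<and> length v \<le> N}" by auto
  then have "finite ?A" by (rule finite_subset) (simp add: finite_lists_length_le)
  moreover have "[] \<in> ?A" by simp
  then have "?A \<noteq> {}" by blast
  ultimately show ?thesis
    unfolding admissible_def by (intro conjI exI[of _ ?A]) simp_all
qed


section \<open>Rigid homeomorphisms between surfaces\<close>

definition rigid_homeos ::
    "nat \<Rightarrow> nat \<Rightarrow> nat list set \<Rightarrow> nat \<Rightarrow> nat \<Rightarrow> nat list set \<Rightarrow> (complex \<Rightarrow> complex) set" where
  "rigid_homeos n m Q n' m' Q' =
     {f. homeomorphic_map (top_of_set (surface n m Q)) (top_of_set (surface n' m' Q')) f \<and>
         orientation_preserving_on (surface n m Q) f \<and>
         almost_rigid (tree_vertices n m) (polygon n m Q) (tree_vertices n' m') (polygon n' m' Q') f}"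

lemma homeomorphic_map_top_of_setD:
  assumes "homeomorphic_map (top_of_set S) (top_of_set T) f"
  shows "continuous_on S f" "inj_on f S" "f ` S = T"
  using assms homeomorphic_imp_continuous_map homeomorphic_imp_injective_map
    homeomorphic_imp_surjective_map by fastforce+

text \<open>Forgetting connectedness loses nothing. In one direction, sending polygons to polygons
  is upgraded to a bijection of indices because \<open>f\<close> is bijective on the surface. In the
  other, the exceptional set is enlarged to all vertices up to some depth, and the image of that
  connected surface is connected by continuity.\<close>

lemma asymp_rigid_homeos_eq: "asymp_rigid_homeos n m Q = rigid_homeos n m Q n m Q"
proof -
  define V where "V = tree_vertices n m"
  define P where "P = polygon n m Q"
  define S where "S = surface n m Q"
  have S: "\<Union>(P ` V) = S" using Union_polygon by (simp add: P_def V_def S_def)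
  have inner: "inner_point n m u \<in> P v \<longleftrightarrow> u = v" if "u \<in> V" "v \<in> V" for u v
    using that inner_point_in_polygon_iff by (simp add: P_def V_def)
  have inj: "u = v" if "P u = P v" "u \<in> V" "v \<in> V" for u v
    using that inner[of u u] inner[of u v] by simp
  have sub_iff: "P v \<subseteq> \<Union>(P ` A) \<longleftrightarrow> v \<in> A" if "v \<in> V" "A \<subseteq> V" for v A
    using that polygon_subset_Union_iff by (simp add: P_def V_def)
  have "(\<exists>\<Sigma>. admissible n m Q \<Sigma> \<and> admissible n m Q (f ` \<Sigma>) \<and>
              (\<forall>v\<in>V. \<not> P v \<subseteq> \<Sigma> \<longrightarrow> f ` P v \<in> P ` V)) \<longleftrightarrow> almost_rigid V P V P f" (is "?L \<longleftrightarrow> ?R")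
    if "self_homeomorphism S f" for f
  proof
    note f = homeomorphic_map_top_of_setD[OF that]
    assume ?L
    then obtain \<Sigma> where adm: "admissible n m Q \<Sigma>" "admissible n m Q (f ` \<Sigma>)"
      and *: "\<forall>v\<in>V. \<not> P v \<subseteq> \<Sigma> \<longrightarrow> f ` P v \<in> P ` V"
      by (elim exE conjE)
    obtain A where A: "finite A" "A \<subseteq> V" "\<Sigma> = \<Union>(P ` A)"
      using adm(1) unfolding admissible_def P_def V_def by (elim exE conjE)
    obtain B where B: "finite B" "B \<subseteq> V" "f ` \<Sigma> = \<Union>(P ` B)"
      using adm(2) unfolding admissible_def P_def V_def by (elim exE conjE)
    have AB: "f ` \<Union>(P ` A) = \<Union>(P ` B)" using A(3) B(3) by simp
    have "\<exists>u. u \<in> V \<and> f ` P v = P u" if v: "v \<in> V - A" for v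
    proof -
      have "\<not> P v \<subseteq> \<Sigma>" using sub_iff[of v A] A(2,3) v by simp
      then have "f ` P v \<in> P ` V" using * v by simp
      then show ?thesis by (auto elim: imageE)
    qed
    then obtain \<sigma> where \<sigma>: "\<And>v. v \<in> V - A \<Longrightarrow> \<sigma> v \<in> V" "\<And>v. v \<in> V - A \<Longrightarrow> f ` P v = P (\<sigma> v)"
      by metis
    have PS: "P v \<subseteq> S" if "v \<in> V" for v using S that by blast
    have "inj_on \<sigma> (V - A)"
    proof (rule inj_onI)
      fix u v assume uv: "u \<in> V - A" "v \<in> V - A" "\<sigma> u = \<sigma> v"
      then have "f ` P u = f ` P v" using \<sigma>(2) by simp
      then have "P u = P v"
        using uv PS by (subst (asm) inj_on_image_eq_iff[OF f(2)]) auto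
      then show "u = v" using inj uv by blast
    qed
    \<comment> \<open>If the image polygon lay in the exceptional image, injectivity of
      \<open>f\<close> would place \<open>P v\<close> inside the union over \<open>A\<close>, which
      its inner point forbids.\<close>
    moreover have "\<sigma> ` (V - A) \<subseteq> V - B"
    proof clarify
      fix v assume v: "v \<in> V" "v \<notin> A"
      have "\<sigma> v \<notin> B"
      proof
        assume "\<sigma> v \<in> B"
        then have "P (\<sigma> v) \<subseteq> \<Union>(P ` B)" by (rule UN_upper)
        moreover have "f ` P v = P (\<sigma> v)" using \<sigma>(2) v by simp
        ultimately have "f ` P v \<subseteq> f ` \<Union>(P ` A)" by (simp only: AB)
        moreover have "\<Union>(P ` A) \<subseteq> S" using A(2) PS by (intro UN_least) (rule PS, rule subsetD)
        ultimately have "P v \<subseteq> \<Union>(P ` A)"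
          by (simp only: inj_on_image_subset_iff[OF f(2) PS[OF v(1)]])
        then show False using sub_iff[OF v(1) A(2)] v(2) by simp
      qed
      then show "\<sigma> v \<in> V - B" using \<sigma>(1) v by blast
    qed
    \<comment> \<open>The inner point of \<open>u\<close> has a preimage; the polygon containing
      that preimage is the one sent to \<open>P u\<close>.\<close>
    moreover have "V - B \<subseteq> \<sigma> ` (V - A)"
    proof
      fix u assume u: "u \<in> V - B"
      then have "inner_point n m u \<in> P u" using inner[of u u] by simp
      then have "inner_point n m u \<in> f ` S" using PS[of u] u f(3) by auto
      then obtain y where y: "y \<in> S" "inner_point n m u = f y" by (rule imageE) auto
      then obtain v where v: "v \<in> V" "y \<in> P v" unfolding S[symmetric] by (rule_tac UN_E) auto
      have "v \<notin> A"
      proof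
        assume "v \<in> A"
        then have "y \<in> \<Union>(P ` A)" using v(2) by (rule UN_I)
        then have "inner_point n m u \<in> \<Union>(P ` B)" using AB y(2) by auto
        then obtain w where "w \<in> B" "inner_point n m u \<in> P w" by (rule UN_E)
        then show False using inner[of u w] u B(2) by auto
      qed
      then have \<sigma>v: "\<sigma> v \<in> V" "f ` P v = P (\<sigma> v)" using \<sigma>[of v] v(1) by simp_all
      then have "inner_point n m u \<in> P (\<sigma> v)" using y(2) v(2) by auto
      then have "u = \<sigma> v" using inner[of u "\<sigma> v"] u \<sigma>v(1) by simp
      then show "u \<in> \<sigma> ` (V - A)" using v(1) \<open>v \<notin> A\<close> by simp
    qed
    ultimately have "bij_betw \<sigma> (V - A) (V - B)" by (auto simp: bij_betw_def)
    then show ?R unfolding almost_rigid_def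
      using A B AB \<sigma>(2) by (intro exI[of _ A] exI[of _ B] exI[of _ \<sigma>]) simp
  next
    note f = homeomorphic_map_top_of_setD[OF that]
    assume ?R
    obtain A B \<sigma> where A: "finite A" "A \<subseteq> V" "finite B" "B \<subseteq> V" "f ` \<Union>(P ` A) = \<Union>(P ` B)"
      "bij_betw \<sigma> (V - A) (V - B)" "\<forall>v\<in>V - A. f ` P v = P (\<sigma> v)"
      using \<open>?R\<close> by (rule almost_rigidE)
    \<comment> \<open>For empty \<open>A\<close> the maximum is an unspecified natural number; the
      inclusion \<open>A \<subseteq> A'\<close> is then trivial, and \<open>A'\<close> still
      contains the root.\<close>
    define N where "N = Max (length ` A)"
    define A' where "A' = {v \<in> V. length v \<le> N}"
    have sub: "A \<subseteq> A'" "A' \<subseteq> V" using A(1,2) by (auto simp: A'_def N_def)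
    note f' = rigid_outside_larger_set[OF A(5,4,6,7) sub]
    have adm: "admissible n m Q (\<Union>(P ` A'))"
      using admissible_bounded_depth by (simp add: A'_def V_def P_def)
    \<comment> \<open>The finite index set provided by \<open>admissible\<close> must contain
      \<open>A'\<close>, since a union of polygons determines its indices.\<close>
    have "finite A'"
    proof -
      obtain C where C: "finite C" "C \<subseteq> V" "\<Union>(P ` A') = \<Union>(P ` C)"
        using adm unfolding admissible_def P_def V_def by (elim exE conjE)
      have "v \<in> C" if "v \<in> A'" for v
      proof -
        have "P v \<subseteq> \<Union>(P ` A')" using that by (rule UN_upper)
        then show ?thesis using sub_iff[of v C] C(2,3) that sub(2) by auto
      qed
      then show ?thesis using C(1) by (meson finite_subset subsetI)
    qed
    then have fin: "finite (B \<union> \<sigma> ` (A' - A))" using A(3) by auto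
    have con: "connected (f ` \<Union>(P ` A'))"
    proof (rule connected_continuous_image)
      have "\<Union>(P ` A') \<subseteq> S" unfolding S[symmetric] using sub(2) by (rule UN_mono) simp
      then show "continuous_on (\<Union>(P ` A')) f" using f(1) continuous_on_subset by blast
      show "connected (\<Union>(P ` A'))" using adm by (simp add: admissible_def)
    qed
    have "[] \<in> A'" by (simp add: A'_def V_def)
    moreover have "inner_point n m [] \<in> P []" using inner[of "[]" "[]"] by (simp add: V_def)
    ultimately have "\<Union>(P ` A') \<noteq> {}" by blast
    then have "f ` \<Union>(P ` A') \<noteq> {}" by simp
    then have "B \<union> \<sigma> ` (A' - A) \<noteq> {}" unfolding f'(1) by blast
    then have "admissible n m Q (f ` \<Union>(P ` A'))"
      unfolding admissible_def using con fin f'(1,2) unfolding P_def V_def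
      by (intro conjI exI[of _ "B \<union> \<sigma> ` (A' - A)"])
    moreover have "f ` P v \<in> P ` V" if v: "v \<in> V" "\<not> P v \<subseteq> \<Union>(P ` A')" for v
    proof -
      have "v \<notin> A'" using v(2) UN_upper[of v A' P] by argo
      then have v': "v \<in> V - A" using v(1) sub(1) by auto
      then have "f ` P v = P (\<sigma> v)" using A(7) by simp
      moreover have "\<sigma> v \<in> V - B" using A(6) v' by (rule bij_betwE[THEN bspec])
      ultimately show ?thesis by simp
    qed
    ultimately show ?L using adm by (intro exI[of _ "\<Union>(P ` A')"]) simp
  qed
  then have "(self_homeomorphism S f \<and> orientation_preserving_on S f \<and>
        (\<exists>\<Sigma>. admissible n m Q \<Sigma> \<and> admissible n m Q (f ` \<Sigma>) \<and>
              (\<forall>v\<in>V. \<not> P v \<subseteq> \<Sigma> \<longrightarrow> f ` P v \<in> P ` V))) \<longleftrightarrow>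
      (self_homeomorphism S f \<and> orientation_preserving_on S f \<and> almost_rigid V P V P f)" for f
    by (intro conj_cong refl)
  then show ?thesis
    unfolding asymp_rigid_homeos_def rigid_homeos_def S_def V_def P_def by (rule Collect_cong)
qed

lemma rigid_homeos_comp:
  assumes "f \<in> rigid_homeos n m Q n' m' Q'" "g \<in> rigid_homeos n' m' Q' n'' m'' Q''"
  shows "g \<circ> f \<in> rigid_homeos n m Q n'' m'' Q''"
proof -
  have *: "homeomorphic_map (top_of_set (surface n m Q)) (top_of_set (surface n' m' Q')) f"
    "homeomorphic_map (top_of_set (surface n' m' Q')) (top_of_set (surface n'' m'' Q'')) g"
    using assms by (auto simp: rigid_homeos_def)
  note f = homeomorphic_map_top_of_setD[OF *(1)] and g = homeomorphic_map_top_of_setD[OF *(2)]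
  have "orientation_preserving_on (surface n m Q) (g \<circ> f)"
    using assms f g by (intro orientation_preserving_on_comp) (auto simp: rigid_homeos_def)
  then show ?thesis
    using assms by (auto simp: rigid_homeos_def intro: almost_rigid_comp homeomorphic_map_compose)
qed

text \<open>Values off the surface are arbitrary, so the inverse laws can be asked for on the
  surfaces only.\<close>

lemma rigid_homeos_inverse:
  assumes "f \<in> rigid_homeos n m Q n' m' Q'"
  obtains g where "g \<in> rigid_homeos n' m' Q' n m Q"
    "\<And>z. z \<in> surface n m Q \<Longrightarrow> g (f z) = z" "\<And>z. z \<in> surface n' m' Q' \<Longrightarrow> f (g z) = z"
proof -
  have *: "homeomorphic_map (top_of_set (surface n m Q)) (top_of_set (surface n' m' Q')) f"
    using assms by (auto simp: rigid_homeos_def)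
  then obtain g where g: "homeomorphic_maps (top_of_set (surface n m Q)) (top_of_set (surface n' m' Q')) f g"
    using homeomorphic_map_maps by blast
  then have gf: "z \<in> surface n m Q \<Longrightarrow> g (f z) = z" and fg: "z \<in> surface n' m' Q' \<Longrightarrow> f (g z) = z" for z
    by (auto simp: homeomorphic_maps_def)
  have g': "homeomorphic_map (top_of_set (surface n' m' Q')) (top_of_set (surface n m Q)) g"
    using g homeomorphic_maps_map by blast
  note f = homeomorphic_map_top_of_setD[OF *] and gD = homeomorphic_map_top_of_setD[OF g']
  have "orientation_preserving_on (surface n' m' Q') g"
  proof (rule orientation_preserving_on_inverse[OF f(1,2) _ gD(1,2) _ fg])
    show "orientation_preserving_on (surface n m Q) f" using assms by (simp add: rigid_homeos_def)
    show "g ` surface n' m' Q' \<subseteq> surface n m Q" by (simp add: gD(3))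
  qed
  moreover have "almost_rigid (tree_vertices n' m') (polygon n' m' Q') (tree_vertices n m) (polygon n m Q) g"
  proof (rule almost_rigid_inverse)
    show "almost_rigid (tree_vertices n m) (polygon n m Q) (tree_vertices n' m') (polygon n' m' Q') f"
      using assms by (simp add: rigid_homeos_def)
    show "g (f z) = z" if "z \<in> \<Union>(polygon n m Q ` tree_vertices n m)" for z
      using that unfolding Union_polygon by (rule gf)
  qed
  ultimately have "g \<in> rigid_homeos n' m' Q' n m Q" using g' by (simp add: rigid_homeos_def)
  then show ?thesis using gf fg by (rule that)
qed

lemma id_in_rigid_homeos: "id \<in> rigid_homeos n m Q n m Q"
  by (simp add: rigid_homeos_def orientation_preserving_on_id almost_rigid_id)

lemma isotopy_relI:
  assumes "f \<in> asymp_rigid_homeos n m Q" "g \<in> asymp_rigid_homeos n m Q"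
    and "\<And>z. z \<in> surface n m Q \<Longrightarrow> f z = g z"
  shows "(f, g) \<in> isotopy_rel n m Q"
  using assms homotopic_self_homeomorphism_cong[of "surface n m Q" f g]
  by (auto simp: isotopy_rel_def asymp_rigid_homeos_def)

lemma equiv_isotopy_rel: "equiv (asymp_rigid_homeos n m Q) (isotopy_rel n m Q)"
proof (rule equivI)
  show "isotopy_rel n m Q \<subseteq> asymp_rigid_homeos n m Q \<times> asymp_rigid_homeos n m Q"
    by (auto simp: isotopy_rel_def)
  show "refl_on (asymp_rigid_homeos n m Q) (isotopy_rel n m Q)"
    by (auto simp: refl_on_def intro: isotopy_relI)
  show "sym (isotopy_rel n m Q)"
    by (auto simp: sym_def isotopy_rel_def homotopic_with_sym)
  show "trans (isotopy_rel n m Q)"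
    by (auto simp: trans_def isotopy_rel_def intro: homotopic_with_trans)
qed

text \<open>With one of \<open>h\<close>, \<open>k\<close> the identity this gives well-definedness
  of the product; with \<open>k\<close> inverse to \<open>h\<close> on the surfaces it gives that of
  conjugation.\<close>

lemma isotopy_rel_comp:
  assumes f: "(f, f') \<in> isotopy_rel n m Q" and h: "h \<in> rigid_homeos n m Q n' m' Q'"
    and k: "k \<in> rigid_homeos n' m' Q' n m Q"
  shows "(h \<circ> f \<circ> k, h \<circ> f' \<circ> k) \<in> isotopy_rel n' m' Q'"
proof -
  let ?S = "top_of_set (surface n m Q)" and ?S' = "top_of_set (surface n' m' Q')"
  have ff: "f \<in> rigid_homeos n m Q n m Q" "f' \<in> rigid_homeos n m Q n m Q"
    using f by (auto simp: isotopy_rel_def asymp_rigid_homeos_eq)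
  have hk: "homeomorphic_map ?S ?S' h" "homeomorphic_map ?S' ?S k"
    using h k by (auto simp: rigid_homeos_def)
  have "homotopic_with (homeomorphic_map ?S ?S) ?S ?S f f'" using f by (simp add: isotopy_rel_def)
  then have "homotopic_with (homeomorphic_map ?S ?S') ?S ?S' (h \<circ> f) (h \<circ> f')"
    by (rule homotopic_with_compose_continuous_map_left)
      (rule homeomorphic_imp_continuous_map[OF hk(1)], rule homeomorphic_map_compose[OF _ hk(1)])
  then have "homotopic_with (homeomorphic_map ?S' ?S') ?S' ?S' (h \<circ> f \<circ> k) (h \<circ> f' \<circ> k)"
    by (rule homotopic_with_compose_continuous_map_right)
      (rule homeomorphic_imp_continuous_map[OF hk(2)], rule homeomorphic_map_compose[OF hk(2)])
  then show ?thesis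
    using ff h k by (auto simp: isotopy_rel_def asymp_rigid_homeos_eq intro!: rigid_homeos_comp)
qed


section \<open>Mapping class groups\<close>

abbreviation mapping_class :: "nat \<Rightarrow> nat \<Rightarrow> nat list set \<Rightarrow> (complex \<Rightarrow> complex) \<Rightarrow> (complex \<Rightarrow> complex) set" where
  "mapping_class n m Q f \<equiv> isotopy_rel n m Q `` {f}"

lemma asymp_rigid_homeos_comp:
  "f \<in> asymp_rigid_homeos n m Q \<Longrightarrow> g \<in> asymp_rigid_homeos n m Q \<Longrightarrow> f \<circ> g \<in> asymp_rigid_homeos n m Q"
  unfolding asymp_rigid_homeos_eq by (rule rigid_homeos_comp)

lemma carrier_mapping_class_group:
  "carrier (mapping_class_group n m Q) = mapping_class n m Q ` asymp_rigid_homeos n m Q"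
  by (auto simp: mapping_class_group_def quotient_def)

lemma one_mapping_class_group: "\<one>\<^bsub>mapping_class_group n m Q\<^esub> = mapping_class n m Q id"
  by (simp add: mapping_class_group_def)

lemma mapping_class_eq:
  "(f, g) \<in> isotopy_rel n m Q \<Longrightarrow> mapping_class n m Q f = mapping_class n m Q g"
  using equiv_isotopy_rel by (rule equiv_class_eq)

lemma mult_mapping_class_group:
  assumes "f \<in> asymp_rigid_homeos n m Q" "g \<in> asymp_rigid_homeos n m Q"
  shows "mapping_class n m Q f \<otimes>\<^bsub>mapping_class_group n m Q\<^esub> mapping_class n m Q g = mapping_class n m Q (f \<circ> g)"
proof -
  have "congruent2 (isotopy_rel n m Q) (isotopy_rel n m Q) (\<lambda>f g. mapping_class n m Q (f \<circ> g))"
  proof (rule congruent2I[OF equiv_isotopy_rel equiv_isotopy_rel]; rule mapping_class_eq)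
    fix f g h assume "h \<in> asymp_rigid_homeos n m Q" "(f, g) \<in> isotopy_rel n m Q"
    then show "(f \<circ> h, g \<circ> h) \<in> isotopy_rel n m Q" "(h \<circ> f, h \<circ> g) \<in> isotopy_rel n m Q"
      using isotopy_rel_comp[of f g n m Q id n m Q h] isotopy_rel_comp[of f g n m Q h n m Q id]
      by (auto simp: asymp_rigid_homeos_eq id_in_rigid_homeos)
  qed
  then show ?thesis
    unfolding mapping_class_group_def using assms
    by (simp add: UN_equiv_class2[OF equiv_isotopy_rel equiv_isotopy_rel])
qed

lemma group_mapping_class_group: "group (mapping_class_group n m Q)"
proof (rule groupI)
  let ?G = "mapping_class_group n m Q" and ?H = "asymp_rigid_homeos n m Q"
  have id: "id \<in> ?H" by (simp add: asymp_rigid_homeos_eq id_in_rigid_homeos)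
  show "\<one>\<^bsub>?G\<^esub> \<in> carrier ?G"
    using id by (auto simp: one_mapping_class_group carrier_mapping_class_group)
  show "x \<otimes>\<^bsub>?G\<^esub> y \<in> carrier ?G" if "x \<in> carrier ?G" "y \<in> carrier ?G" for x y
    using that by (auto simp: carrier_mapping_class_group mult_mapping_class_group asymp_rigid_homeos_comp)
  show "x \<otimes>\<^bsub>?G\<^esub> y \<otimes>\<^bsub>?G\<^esub> z = x \<otimes>\<^bsub>?G\<^esub> (y \<otimes>\<^bsub>?G\<^esub> z)"
    if "x \<in> carrier ?G" "y \<in> carrier ?G" "z \<in> carrier ?G" for x y z
    using that by (auto simp: carrier_mapping_class_group mult_mapping_class_group asymp_rigid_homeos_comp comp_assoc)
  show "\<one>\<^bsub>?G\<^esub> \<otimes>\<^bsub>?G\<^esub> x = x" if "x \<in> carrier ?G" for x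
    using that id by (auto simp: carrier_mapping_class_group one_mapping_class_group mult_mapping_class_group)
  show "\<exists>y\<in>carrier ?G. y \<otimes>\<^bsub>?G\<^esub> x = \<one>\<^bsub>?G\<^esub>" if x: "x \<in> carrier ?G" for x
  proof -
    obtain f where f: "f \<in> ?H" "x = mapping_class n m Q f"
      using x by (auto simp: carrier_mapping_class_group)
    obtain g where g: "g \<in> ?H" "\<And>z. z \<in> surface n m Q \<Longrightarrow> g (f z) = z"
      using f(1) rigid_homeos_inverse unfolding asymp_rigid_homeos_eq by metis
    have "mapping_class n m Q (g \<circ> f) = mapping_class n m Q id"
      using f g id by (intro mapping_class_eq isotopy_relI asymp_rigid_homeos_comp) auto
    then have "mapping_class n m Q g \<otimes>\<^bsub>?G\<^esub> x = \<one>\<^bsub>?G\<^esub>"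
      using f g by (simp add: mult_mapping_class_group one_mapping_class_group)
    then show ?thesis using g(1) by (auto simp: carrier_mapping_class_group)
  qed
qed

text \<open>The isomorphism is conjugation by \<open>h\<close>. As \<open>k\<close> inverts
  \<open>h\<close> on the surfaces only, the usual identities become equalities after passing to
  isotopy classes.\<close>

lemma mapping_class_group_iso:
  assumes h: "h \<in> rigid_homeos n m Q n' m' Q'"
  shows "mapping_class_group n m Q \<cong> mapping_class_group n' m' Q'"
proof -
  let ?G = "mapping_class_group n m Q" and ?H = "asymp_rigid_homeos n m Q"
  let ?G' = "mapping_class_group n' m' Q'" and ?H' = "asymp_rigid_homeos n' m' Q'"
  let ?c = "mapping_class n m Q" and ?c' = "mapping_class n' m' Q'"
  obtain k where k: "k \<in> rigid_homeos n' m' Q' n m Q"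
    and kh: "\<And>z. z \<in> surface n m Q \<Longrightarrow> k (h z) = z"
    and hk: "\<And>z. z \<in> surface n' m' Q' \<Longrightarrow> h (k z) = z"
    using rigid_homeos_inverse[OF h] by metis
  \<comment> \<open>Cancelling \<open>k\<close> against \<open>h\<close> inside a composite requires
    the intermediate point to lie on the surface.\<close>
  have into: "f z \<in> surface b' c' R'" if "f \<in> rigid_homeos b c R b' c' R'" "z \<in> surface b c R"
    for f z b c R b' c' R'
    using that homeomorphic_map_top_of_setD(3) by (fastforce simp: rigid_homeos_def)
  have conj: "h \<circ> f \<circ> k \<in> ?H'" if "f \<in> ?H" for f
    using that h k unfolding asymp_rigid_homeos_eq by (intro rigid_homeos_comp)
  have conj': "k \<circ> g \<circ> h \<in> ?H" if "g \<in> ?H'" for g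
    using that h k unfolding asymp_rigid_homeos_eq by (intro rigid_homeos_comp)
  have conj_back: "(k \<circ> (h \<circ> f \<circ> k) \<circ> h, f) \<in> isotopy_rel n m Q" if "f \<in> ?H" for f
    using that kh into[of f n m Q n m Q]
    by (intro isotopy_relI conj' conj) (auto simp: asymp_rigid_homeos_eq)
  have conj_forth: "(h \<circ> (k \<circ> g \<circ> h) \<circ> k, g) \<in> isotopy_rel n' m' Q'" if "g \<in> ?H'" for g
    using that hk into[of g n' m' Q' n' m' Q']
    by (intro isotopy_relI conj' conj) (auto simp: asymp_rigid_homeos_eq)
  define \<theta> where "\<theta> X = (\<Union>f\<in>X. ?c' (h \<circ> f \<circ> k))" for X
  have \<theta>: "\<theta> (?c f) = ?c' (h \<circ> f \<circ> k)" if "f \<in> ?H" for f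
    unfolding \<theta>_def
  proof (rule UN_equiv_class[OF equiv_isotopy_rel _ that])
    show "(\<lambda>f. ?c' (h \<circ> f \<circ> k)) respects isotopy_rel n m Q"
      using isotopy_rel_comp[OF _ h k] by (auto simp: congruent_def intro!: mapping_class_eq)
  qed
  have "\<theta> \<in> hom ?G ?G'"
  proof (rule homI)
    show "\<theta> X \<in> carrier ?G'" if "X \<in> carrier ?G" for X
      using that conj \<theta> by (auto simp: carrier_mapping_class_group)
    fix X Y assume "X \<in> carrier ?G" "Y \<in> carrier ?G"
    then obtain f g where f: "f \<in> ?H" "X = ?c f" and g: "g \<in> ?H" "Y = ?c g"
      by (auto simp: carrier_mapping_class_group)
    have "?c' (h \<circ> (f \<circ> g) \<circ> k) = ?c' (h \<circ> f \<circ> k \<circ> (h \<circ> g \<circ> k))"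
    proof (intro mapping_class_eq isotopy_relI)
      show "h \<circ> (f \<circ> g) \<circ> k \<in> ?H'" by (intro conj asymp_rigid_homeos_comp f(1) g(1))
      show "h \<circ> f \<circ> k \<circ> (h \<circ> g \<circ> k) \<in> ?H'" by (intro conj asymp_rigid_homeos_comp f(1) g(1))
      fix z assume "z \<in> surface n' m' Q'"
      then have "g (k z) \<in> surface n m Q"
        using into[OF k] into[OF g(1)[unfolded asymp_rigid_homeos_eq]] by simp
      then show "(h \<circ> (f \<circ> g) \<circ> k) z = (h \<circ> f \<circ> k \<circ> (h \<circ> g \<circ> k)) z" using kh by simp
    qed
    then show "\<theta> (X \<otimes>\<^bsub>?G\<^esub> Y) = \<theta> X \<otimes>\<^bsub>?G'\<^esub> \<theta> Y"
      using f g conj by (simp add: mult_mapping_class_group \<theta> asymp_rigid_homeos_comp)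
  qed
  moreover have "inj_on \<theta> (carrier ?G)"
  proof (rule inj_onI)
    fix X Y assume XY: "X \<in> carrier ?G" "Y \<in> carrier ?G" "\<theta> X = \<theta> Y"
    then obtain f g where f: "f \<in> ?H" "X = ?c f" and g: "g \<in> ?H" "Y = ?c g"
      by (auto simp: carrier_mapping_class_group)
    have "?c' (h \<circ> f \<circ> k) = ?c' (h \<circ> g \<circ> k)" using XY f g \<theta> by simp
    then have "(h \<circ> f \<circ> k, h \<circ> g \<circ> k) \<in> isotopy_rel n' m' Q'"
      using eq_equiv_class[OF _ equiv_isotopy_rel] conj g(1) by blast
    then have "?c (k \<circ> (h \<circ> f \<circ> k) \<circ> h) = ?c (k \<circ> (h \<circ> g \<circ> k) \<circ> h)"
      by (intro mapping_class_eq isotopy_rel_comp[OF _ k h])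
    then show "X = Y" using f g mapping_class_eq[OF conj_back] by metis
  qed
  moreover have "carrier ?G' \<subseteq> \<theta> ` carrier ?G"
  proof
    fix Y assume "Y \<in> carrier ?G'"
    then obtain g where g: "g \<in> ?H'" "Y = ?c' g" by (auto simp: carrier_mapping_class_group)
    then have "Y = \<theta> (?c (k \<circ> g \<circ> h))"
      using mapping_class_eq[OF conj_forth] \<theta> conj' by metis
    then show "Y \<in> \<theta> ` carrier ?G" using conj' g by (auto simp: carrier_mapping_class_group)
  qed
  ultimately have "\<theta> \<in> iso ?G ?G'"
    by (auto simp: iso_def bij_betw_def hom_def)
  then show ?thesis by (rule is_isoI)
qed


section \<open>Monotone maps of the plane\<close>

text \<open>
  Such a map is isotopic to the identity through the straight-line homotopy, all stages of which
  are injective.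
\<close>

definition plane_monotone :: "(complex \<Rightarrow> complex) \<Rightarrow> bool" where
  "plane_monotone h \<longleftrightarrow> continuous_on UNIV h \<and>
     (\<forall>p q. p \<noteq> q \<longrightarrow> 0 < (Re p - Re q) * (Re (h p) - Re (h q)) \<or>
        0 < (Im p - Im q) * (Im (h p) - Im (h q)))"

lemma plane_monotone_inj: "plane_monotone h \<Longrightarrow> inj h"
  unfolding plane_monotone_def inj_def by (metis diff_self mult_zero_right less_irrefl)

text \<open>Here \<open>u\<close> and \<open>v\<close> are the differences of one coordinate of two
  points, before and after a map: the straight-line homotopy never makes that coordinate
  agree.\<close>

lemma convex_combination_same_sign:
  fixes u v t :: real
  assumes "0 < u * v" "0 \<le> t" "t \<le> 1"
  shows "(1 - t) * u + t * v \<noteq> 0"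
proof
  assume eq: "(1 - t) * u + t * v = 0"
  have "u \<noteq> 0" using assms(1) by auto
  have "(1 - t) * (u * u) + t * (u * v) = u * ((1 - t) * u + t * v)" by (simp add: algebra_simps)
  then have sum: "(1 - t) * (u * u) + t * (u * v) = 0" using eq by simp
  have nonneg: "0 \<le> (1 - t) * (u * u)" "0 \<le> t * (u * v)" using assms by auto
  then have "t * (u * v) = 0" using sum by linarith
  then have "t = 0" using assms(1) by (auto simp: zero_less_mult_iff)
  then show False using sum \<open>u \<noteq> 0\<close> by simp
qed

lemma plane_monotone_orientation_preserving:
  assumes "plane_monotone h"
  shows "orientation_preserving_on S h"
  unfolding orientation_preserving_on_def
proof (intro allI impI, elim conjE)
  fix z and r :: real assume r: "0 < r"
  define c where "c = circlepath z r"
  \<comment> \<open>The circle is translated so that its centre becomes \<open>h z\<close>, and both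
    curves wind around the same point. A coordinate whose order \<open>h\<close> respects keeps the
    connecting segment away from it.\<close>
  define c' where "c' t = c t - z + h z" for t
  have c: "path c" "pathfinish c = pathstart c" by (simp_all add: c_def)
  have c': "path c'" using c(1) unfolding path_def c'_def by (intro continuous_intros)
  have hc: "path (h \<circ> c)"
    using c(1) assms by (intro path_continuous_image) (auto simp: plane_monotone_def intro: continuous_on_subset)
  have "homotopic_loops (- {h z}) (h \<circ> c) c'"
  proof (rule homotopic_loops_linear[OF hc c'])
    show "pathfinish (h \<circ> c) = pathstart (h \<circ> c)"
      using c(2) by (simp add: pathfinish_compose pathstart_compose)
    show "pathfinish c' = pathstart c'"
      using c(2) by (simp add: pathfinish_def pathstart_def c'_def)
    fix t x :: real assume t: "t \<in> {0..1}"
    have "c t \<in> path_image c" using t by (simp add: path_image_def)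
    then have cz: "c t \<noteq> z" using r by (auto simp: c_def)
    have "h z \<notin> closed_segment ((h \<circ> c) t) (c' t)"
    proof
      assume "h z \<in> closed_segment ((h \<circ> c) t) (c' t)"
      then have "h z \<in> closed_segment (c' t) (h (c t))" by (simp add: closed_segment_commute)
      then obtain u where u: "0 \<le> u" "u \<le> 1" and eq: "h z = (1 - u) *\<^sub>R c' t + u *\<^sub>R h (c t)"
        by (auto simp: closed_segment_def)
      have "(1 - u) * (Re (c t) - Re z) + u * (Re (h (c t)) - Re (h z)) = 0"
        "(1 - u) * (Im (c t) - Im z) + u * (Im (h (c t)) - Im (h z)) = 0"
        using arg_cong[OF eq, of Re] arg_cong[OF eq, of Im] by (simp_all add: c'_def algebra_simps)
      then show False
        using cz u assms convex_combination_same_sign unfolding plane_monotone_def by blast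
    qed
    then show "closed_segment ((h \<circ> c) t) (c' t) \<subseteq> - {h z}" by blast
  qed
  then have "winding_number (h \<circ> c) (h z) = winding_number c' (h z)"
    by (rule winding_number_homotopic_loops)
  also have "\<dots> = winding_number (\<lambda>t. c' t - h z) 0" by (rule winding_number_offset)
  also have "\<dots> = winding_number c z" unfolding c'_def by (subst winding_number_offset[of c z]) simp
  also have "\<dots> = 1" using r by (simp add: c_def winding_number_circlepath_centre)
  finally show "winding_number (h \<circ> circlepath z r) (h z) = 1" by (simp add: c_def)
qed

lemma plane_monotone_horizontal:
  assumes cont: "continuous_on UNIV (\<lambda>z. a (Re z) (Im z))"
    and mono: "\<And>x x' y. x < x' \<Longrightarrow> a x y < a x' y"
  shows "plane_monotone (\<lambda>z. Complex (a (Re z) (Im z)) (Im z))"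
  unfolding plane_monotone_def
proof (intro conjI allI impI)
  show "continuous_on UNIV (\<lambda>z. Complex (a (Re z) (Im z)) (Im z))"
    using cont unfolding Complex_eq by (intro continuous_intros)
  fix p q :: complex assume "p \<noteq> q"
  show "0 < (Re p - Re q) * (Re (Complex (a (Re p) (Im p)) (Im p)) - Re (Complex (a (Re q) (Im q)) (Im q))) \<or>
    0 < (Im p - Im q) * (Im (Complex (a (Re p) (Im p)) (Im p)) - Im (Complex (a (Re q) (Im q)) (Im q)))"
  proof (cases "Im p = Im q")
    case True
    then have "Re p < Re q \<or> Re q < Re p" using \<open>p \<noteq> q\<close> by (auto simp: complex_eq_iff)
    then show ?thesis using mono True by (auto simp: zero_less_mult_iff)
  qed (auto simp: zero_less_mult_iff)
qed

lemma plane_monotone_vertical: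
  assumes cont: "continuous_on UNIV (\<lambda>z. b (Re z) (Im z))" "continuous_on UNIV \<phi>"
    and mono: "strict_mono \<phi>" "\<And>x y y'. y < y' \<Longrightarrow> b x y < b x y'"
  shows "plane_monotone (\<lambda>z. Complex (\<phi> (Re z)) (b (Re z) (Im z)))"
  unfolding plane_monotone_def
proof (intro conjI allI impI)
  have "continuous_on UNIV (\<lambda>z. \<phi> (Re z))"
    using cont(2) by (intro continuous_on_compose2[OF cont(2)] continuous_intros) auto
  then show "continuous_on UNIV (\<lambda>z. Complex (\<phi> (Re z)) (b (Re z) (Im z)))"
    using cont(1) unfolding Complex_eq by (intro continuous_intros)
  fix p q :: complex assume "p \<noteq> q"
  show "0 < (Re p - Re q) * (Re (Complex (\<phi> (Re p)) (b (Re p) (Im p))) - Re (Complex (\<phi> (Re q)) (b (Re q) (Im q)))) \<or>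
    0 < (Im p - Im q) * (Im (Complex (\<phi> (Re p)) (b (Re p) (Im p))) - Im (Complex (\<phi> (Re q)) (b (Re q) (Im q))))"
  proof (cases "Re p = Re q")
    case True
    then have "Im p < Im q \<or> Im q < Im p" using \<open>p \<noteq> q\<close> by (auto simp: complex_eq_iff)
    then show ?thesis using mono(2) True by (auto simp: zero_less_mult_iff)
  next
    case False
    then show ?thesis
      using mono(1) by (auto simp: zero_less_mult_iff strict_mono_less)
  qed
qed

text \<open>The inequalities are symmetric in a pair of points and the pair of their images;
  continuity of the inverse is invariance of domain.\<close>

lemma plane_monotone_inverse:
  assumes "plane_monotone h" "surj h"
  shows "plane_monotone (inv_into UNIV h)"
  unfolding plane_monotone_def
proof (intro conjI allI impI)
  have "continuous_on UNIV h" "inj h"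
    using assms plane_monotone_inj by (auto simp: plane_monotone_def)
  then obtain g where "homeomorphism UNIV (h ` UNIV) h g"
    using invariance_of_domain_homeomorphism[of UNIV h] by auto
  then have g: "continuous_on UNIV g" "\<And>x. g (h x) = x"
    using assms(2) by (auto simp: homeomorphism_def)
  have "inv_into UNIV h = g" using g(2) assms(2) by (metis ext surj_f_inv_f)
  then show "continuous_on UNIV (inv_into UNIV h)" using g(1) by simp
  fix p q :: complex assume "p \<noteq> q"
  then have "inv_into UNIV h p \<noteq> inv_into UNIV h q" using assms(2) by (metis surj_f_inv_f)
  then show "0 < (Re p - Re q) * (Re (inv_into UNIV h p) - Re (inv_into UNIV h q)) \<or>
      0 < (Im p - Im q) * (Im (inv_into UNIV h p) - Im (inv_into UNIV h q))"
    using assms(1) surj_f_inv_f[OF assms(2)] unfolding plane_monotone_def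
    by (metis mult.commute)
qed

section \<open>Interpolation on the real line\<close>

lemma surj_interval:
  fixes f :: "real \<Rightarrow> real"
  assumes "continuous_on UNIV f" "f u \<le> y" "y \<le> f v" "u \<le> v"
  obtains x where "u \<le> x" "x \<le> v" "f x = y"
  using IVT'[of f u y v] assms continuous_on_subset by blast

text \<open>The tail of slope one keeps the function strictly increasing on the whole line and is
  what each induction step replaces by one more linear piece.\<close>

lemma piecewise_linear_interpolation:
  fixes c :: "nat \<Rightarrow> real"
  assumes "strict_mono c"
  shows "\<exists>\<phi>. continuous_on UNIV \<phi> \<and> strict_mono \<phi> \<and>
    (\<forall>j<N. \<forall>t\<in>{0..1}. \<phi> (real j + t) = c j + t * (c (Suc j) - c j)) \<and>
    (\<forall>s\<ge>real N. \<phi> s = c N + (s - real N))"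
proof (induction N)
  case 0
  show ?case
    by (intro exI[of _ "\<lambda>s. c 0 + s"]) (auto simp: strict_mono_def intro!: continuous_intros)
next
  case (Suc N)
  then obtain \<phi> where \<phi>: "continuous_on UNIV \<phi>" "strict_mono \<phi>"
    "\<forall>j<N. \<forall>t\<in>{0..1}. \<phi> (real j + t) = c j + t * (c (Suc j) - c j)"
    "\<forall>s\<ge>real N. \<phi> s = c N + (s - real N)" by blast
  define w where "w = c (Suc N) - c N"
  have w: "0 < w" using assms by (simp add: w_def strict_mono_def)
  \<comment> \<open>The old function is frozen from \<open>N\<close> on; a ramp of height
    \<open>w\<close> over one unit and then a line of slope one take over.\<close>
  define \<psi> where
    "\<psi> s = \<phi> (min s N) + w * max 0 (min 1 (s - N)) + max 0 (s - N - 1)" for s :: real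
  have "continuous_on UNIV \<psi>"
    unfolding \<psi>_def by (intro continuous_intros continuous_on_compose2[OF \<phi>(1)]) auto
  moreover have "strict_mono \<psi>"
  proof (rule strict_monoI)
    fix s t :: real assume st: "s < t"
    have mono: "max 0 (min 1 (s - N)) \<le> max 0 (min 1 (t - N))" "max 0 (s - N - 1) \<le> max 0 (t - N - 1)"
      using st by auto
    then have wm: "w * max 0 (min 1 (s - N)) \<le> w * max 0 (min 1 (t - N))"
      using w by (intro mult_left_mono) auto
    have \<phi>m: "\<phi> (min s N) \<le> \<phi> (min t N)" using \<phi>(2) st by (simp add: strict_mono_less_eq)
    consider "s < N" | "N \<le> s" "s < N + 1" | "N + 1 \<le> s" by linarith
    then show "\<psi> s < \<psi> t"
    proof cases
      case 1
      then have "\<phi> (min s N) < \<phi> (min t N)" using \<phi>(2) st by (simp add: strict_mono_less)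
      then show ?thesis using mono wm unfolding \<psi>_def by linarith
    next
      case 2
      then have "max 0 (min 1 (s - N)) < max 0 (min 1 (t - N))" using st by auto
      then have "w * max 0 (min 1 (s - N)) < w * max 0 (min 1 (t - N))"
        using w by (intro mult_strict_left_mono) auto
      then show ?thesis using mono(2) \<phi>m unfolding \<psi>_def by linarith
    next
      case 3
      then have "max 0 (s - N - 1) < max 0 (t - N - 1)" using st by auto
      then show ?thesis using wm \<phi>m unfolding \<psi>_def by linarith
    qed
  qed
  moreover have "\<psi> (real j + t) = c j + t * (c (Suc j) - c j)" if j: "j < Suc N" "t \<in> {0..1}" for j t
  proof (cases "j = N")
    case True
    then show ?thesis using j \<phi>(4) by (cases "t = 1") (auto simp: \<psi>_def w_def min_def max_def)
  next
    case False
    then have "j < N" using j by simp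
    then have "real j + t \<le> N" using j(2) by (auto simp: nat_less_real_le)
    then show ?thesis using \<phi>(3) j \<open>j < N\<close> by (simp add: \<psi>_def min_def max_def)
  qed
  moreover have "\<psi> s = c (Suc N) + (s - real (Suc N))" if "real (Suc N) \<le> s" for s
    using that \<phi>(4) by (simp add: \<psi>_def w_def min_def max_def)
  ultimately show ?case by blast
qed


section \<open>Absorbing a child of the central vertex\<close>

text \<open>With slope one third, the difference of two tents has Lipschitz constant at most two
  thirds, so adding it to the identity preserves strict monotonicity. The support has radius
  \<open>3 * \<delta>\<close>.\<close>

definition tent :: "real \<Rightarrow> real \<Rightarrow> real \<Rightarrow> real" where
  "tent \<delta> c x = max 0 (\<delta> - \<bar>x - c\<bar> / 3)"

lemma tent_lipschitz: "\<bar>tent \<delta> c x - tent \<delta> c y\<bar> \<le> \<bar>x - y\<bar> / 3"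
proof -
  have "\<bar>max 0 u - max 0 v\<bar> \<le> \<bar>u - v\<bar>" for u v :: real by (simp add: max_def)
  then have "\<bar>tent \<delta> c x - tent \<delta> c y\<bar> \<le> \<bar>(\<delta> - \<bar>x - c\<bar> / 3) - (\<delta> - \<bar>y - c\<bar> / 3)\<bar>"
    unfolding tent_def .
  also have "(\<delta> - \<bar>x - c\<bar> / 3) - (\<delta> - \<bar>y - c\<bar> / 3) = - ((\<bar>x - c\<bar> - \<bar>y - c\<bar>) / 3)"
    by (simp add: diff_divide_distrib)
  also have "\<bar>\<dots>\<bar> = \<bar>\<bar>x - c\<bar> - \<bar>y - c\<bar>\<bar> / 3" by simp
  also have "\<dots> \<le> \<bar>x - y\<bar> / 3" using abs_triangle_ineq3[of "x - c" "y - c"] by simp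
  finally show ?thesis .
qed

lemma tent_bounds: "0 \<le> \<delta> \<Longrightarrow> 0 \<le> tent \<delta> c x \<and> tent \<delta> c x \<le> \<delta>"
  by (simp add: tent_def)

lemma tent_eq_0: "3 * \<delta> \<le> \<bar>x - c\<bar> \<Longrightarrow> tent \<delta> c x = 0"
  by (simp add: tent_def)

lemma perturbed_identity_strict:
  fixes d :: "real \<Rightarrow> real"
  assumes "\<bar>d x - d y\<bar> \<le> k * \<bar>x - y\<bar>" "\<bar>s\<bar> * k < 1" "x < y"
  shows "x + s * d x < y + s * d y"
proof -
  have "\<bar>s * (d x - d y)\<bar> \<le> \<bar>s\<bar> * (k * \<bar>x - y\<bar>)"
    unfolding abs_mult using assms(1) by (intro mult_left_mono) auto
  also have "\<dots> = (\<bar>s\<bar> * k) * (y - x)" using assms(3) by simp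
  also have "\<dots> < 1 * (y - x)" using assms(2,3) by (intro mult_strict_right_mono) auto
  finally show ?thesis by (auto simp: algebra_simps abs_if split: if_splits)
qed

text \<open>
  Pulls the sides of the column \<open>[a,b] \<times> [1,2]\<close> inwards: the union of the unit square with
  this column is sent to the region between the real axis and a trapezoid.
\<close>

definition squeeze :: "real \<Rightarrow> real \<Rightarrow> real \<Rightarrow> complex \<Rightarrow> complex" where
  "squeeze a b \<delta> z =
     Complex (Re z + max 0 (min 1 (Im z - 1)) * (tent \<delta> a (Re z) - tent \<delta> b (Re z))) (Im z)"

text \<open>At height \<open>1 + s\<close> squeezing moves the walls of the column to
  \<open>a + s * \<delta>\<close> and \<open>b - s * \<delta>\<close>, where the sloping sides of
  this graph reach \<open>s\<close>.\<close>

definition trapezoid :: "real \<Rightarrow> real \<Rightarrow> real \<Rightarrow> real \<Rightarrow> real" where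
  "trapezoid a b \<delta> x = max 0 (min 1 (min ((x - a) / \<delta>) ((b - x) / \<delta>)))"

lemma tent_difference_lipschitz:
  "\<bar>(tent \<delta> a x - tent \<delta> b x) - (tent \<delta> a y - tent \<delta> b y)\<bar> \<le> 2/3 * \<bar>x - y\<bar>"
  using tent_lipschitz[of \<delta> a x y] tent_lipschitz[of \<delta> b x y] by linarith

lemma plane_monotone_squeeze: "plane_monotone (squeeze a b \<delta>)"
  unfolding squeeze_def
proof (rule plane_monotone_horizontal)
  show "continuous_on UNIV (\<lambda>z. Re z + max 0 (min 1 (Im z - 1)) * (tent \<delta> a (Re z) - tent \<delta> b (Re z)))"
    unfolding tent_def by (intro continuous_intros) auto
  show "x + max 0 (min 1 (y - 1)) * (tent \<delta> a x - tent \<delta> b x)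
      < x' + max 0 (min 1 (y - 1)) * (tent \<delta> a x' - tent \<delta> b x')" if "x < x'" for x x' y :: real
  proof (rule perturbed_identity_strict[OF tent_difference_lipschitz _ that])
    define s where "s = max 0 (min 1 (y - 1))"
    have "0 \<le> s" "s \<le> 1" by (simp_all add: s_def)
    then show "\<bar>max 0 (min 1 (y - 1))\<bar> * (2/3) < 1" by (simp flip: s_def)
  qed
qed

lemma surj_squeeze:
  assumes "0 \<le> \<delta>"
  shows "surj (squeeze a b \<delta>)"
  unfolding surj_def
proof
  fix w :: complex
  define s where "s = max 0 (min 1 (Im w - 1))"
  have s: "0 \<le> s" "s \<le> 1" by (auto simp: s_def)
  define f where "f x = x + s * (tent \<delta> a x - tent \<delta> b x)" for x
  have "\<bar>s * (tent \<delta> a x - tent \<delta> b x)\<bar> \<le> 1 * \<delta>" for x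
    unfolding abs_mult using s assms tent_bounds[of \<delta> a x] tent_bounds[of \<delta> b x]
    by (intro mult_mono) auto
  then have "f (Re w - \<delta>) \<le> Re w" "Re w \<le> f (Re w + \<delta>)"
    unfolding f_def by (smt (verit))+
  moreover have "continuous_on UNIV f"
    unfolding f_def tent_def by (intro continuous_intros) auto
  ultimately obtain x where "f x = Re w"
    using surj_interval[of f "Re w - \<delta>" "Re w" "Re w + \<delta>"] assms by auto
  then have "squeeze a b \<delta> (Complex x (Im w)) = w"
    by (simp add: squeeze_def f_def s_def)
  then show "\<exists>z. w = squeeze a b \<delta> z" by metis
qed

lemma squeeze_fixed:
  assumes "Im z \<le> 1 \<or> 3 * \<delta> \<le> \<bar>Re z - a\<bar> \<and> 3 * \<delta> \<le> \<bar>Re z - b\<bar>"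
  shows "squeeze a b \<delta> z = z"
  using assms by (auto simp: squeeze_def tent_eq_0 complex_eq_iff)

text \<open>Points up to height one stay fixed; at height \<open>1 + s\<close> an increasing
  function carries \<open>[a,b]\<close> onto the part of the line below the trapezoid. The gap
  condition keeps the two tents apart, so each wall moves by exactly
  \<open>s * \<delta>\<close>.\<close>

lemma squeeze_square_with_column:
  assumes "0 < \<delta>" "6 * \<delta> \<le> b - a" "0 \<le> a" "b \<le> 1"
  shows "squeeze a b \<delta> ` ({z. Re z \<in> {0..1} \<and> Im z \<in> {0..1}} \<union> {z. Re z \<in> {a..b} \<and> Im z \<in> {1..2}}) =
    {z. Re z \<in> {0..1} \<and> 0 \<le> Im z \<and> Im z \<le> 1 + trapezoid a b \<delta> (Re z)}"
    (is "?L ` (?S \<union> ?C) = ?R")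
proof -
  define f where "f s x = x + s * (tent \<delta> a x - tent \<delta> b x)" for s x
  have f_ab: "f s a = a + s * \<delta>" "f s b = b - s * \<delta>" for s
    using assms by (simp_all add: f_def tent_eq_0 tent_def max_def)
  have mono: "f s x \<le> f s y" if "x \<le> y" "0 \<le> s" "s \<le> 1" for s x y
    using that perturbed_identity_strict[OF tent_difference_lipschitz[of \<delta> a x b y], of s]
    by (cases "x = y") (auto simp: f_def)
  have trap: "1 + trapezoid a b \<delta> x \<ge> 1" for x by (simp add: trapezoid_def)
  have trap_iff: "s \<le> trapezoid a b \<delta> x \<longleftrightarrow> f s a \<le> x \<and> x \<le> f s b" if "0 < s" "s \<le> 1" for s x
  proof -
    have "s \<le> trapezoid a b \<delta> x \<longleftrightarrow> s \<le> (x - a) / \<delta> \<and> s \<le> (b - x) / \<delta>"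
      using that by (auto simp: trapezoid_def le_max_iff_disj)
    then show ?thesis using assms(1) unfolding f_ab by (auto simp: pos_le_divide_eq)
  qed
  have L: "?L z = Complex (f (Im z - 1) (Re z)) (Im z)" if "1 \<le> Im z" "Im z \<le> 2" for z
    using that by (simp add: squeeze_def f_def)
  have "?L z \<in> ?R" if z: "z \<in> ?S \<union> ?C" for z
  proof (cases "Im z \<le> 1")
    case True
    then have "z \<in> ?R" using z trap[of "Re z"] assms by auto
    then show ?thesis using squeeze_fixed True by auto
  next
    case False
    then have z': "Re z \<in> {a..b}" "1 < Im z" "Im z \<le> 2" using z by auto
    then have "f (Im z - 1) a \<le> f (Im z - 1) (Re z)" "f (Im z - 1) (Re z) \<le> f (Im z - 1) b"
      using mono by auto
    moreover have "a \<le> f (Im z - 1) a" "f (Im z - 1) b \<le> b"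
      unfolding f_ab using z' assms by auto
    ultimately show ?thesis
      using z' L[of z] trap_iff[of "Im z - 1" "f (Im z - 1) (Re z)"] assms by auto
  qed
  moreover have "z \<in> ?L ` (?S \<union> ?C)" if z: "z \<in> ?R" for z
  proof (cases "Im z \<le> 1")
    case True
    then have zS: "z \<in> ?S" using z by simp
    show ?thesis
    proof (rule image_eqI)
      show "z = ?L z" using True by (simp add: squeeze_fixed)
      show "z \<in> ?S \<union> ?C" using zS by (rule UnI1)
    qed
  next
    case False
    moreover have "trapezoid a b \<delta> (Re z) \<le> 1" by (simp add: trapezoid_def)
    ultimately have z': "1 < Im z" "Im z \<le> 2" "Im z - 1 \<le> trapezoid a b \<delta> (Re z)" using z by auto
    then have "f (Im z - 1) a \<le> Re z" "Re z \<le> f (Im z - 1) b"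
      using trap_iff[of "Im z - 1" "Re z"] by auto
    moreover have "continuous_on UNIV (f (Im z - 1))"
      unfolding f_def tent_def by (intro continuous_intros) auto
    ultimately obtain x where x: "a \<le> x" "x \<le> b" "f (Im z - 1) x = Re z"
      using surj_interval[of "f (Im z - 1)" a "Re z" b] assms by auto
    show ?thesis
    proof (rule image_eqI)
      show "z = ?L (Complex x (Im z))" using z' L[of "Complex x (Im z)"] x(3) by simp
      show "Complex x (Im z) \<in> ?S \<union> ?C" using z' x(1,2) by simp
    qed
  qed
  ultimately show ?thesis by blast
qed

text \<open>
  The stretching is complete at height \<open>1/2\<close>: the centre of the unit square is raised by the
  full amount, and everything above the square is translated.
\<close>

definition raise :: "(real \<Rightarrow> real) \<Rightarrow> (real \<Rightarrow> real) \<Rightarrow> complex \<Rightarrow> complex" where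
  "raise \<phi> \<eta> z = Complex (\<phi> (Re z)) (Im z + \<eta> (\<phi> (Re z)) * max 0 (min 1 (2 * Im z)))"

lemma plane_monotone_raise:
  assumes "continuous_on UNIV \<phi>" "strict_mono \<phi>" "continuous_on UNIV \<eta>" "\<And>x. 0 \<le> \<eta> x"
  shows "plane_monotone (raise \<phi> \<eta>)"
  unfolding raise_def
proof (rule plane_monotone_vertical[OF _ assms(1,2)])
  have "continuous_on UNIV (\<lambda>z. \<eta> (\<phi> (Re z)))"
    by (intro continuous_on_compose2[OF assms(3)] continuous_on_compose2[OF assms(1)] continuous_intros) auto
  then show "continuous_on UNIV (\<lambda>z. Im z + \<eta> (\<phi> (Re z)) * max 0 (min 1 (2 * Im z)))"
    by (intro continuous_intros)
  fix x y y' :: real assume "y < y'"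
  moreover have "\<eta> (\<phi> x) * max 0 (min 1 (2 * y)) \<le> \<eta> (\<phi> x) * max 0 (min 1 (2 * y'))"
    using assms(4) \<open>y < y'\<close> by (intro mult_left_mono) auto
  ultimately show "y + \<eta> (\<phi> x) * max 0 (min 1 (2 * y)) < y' + \<eta> (\<phi> x) * max 0 (min 1 (2 * y'))"
    by simp
qed

lemma raise_square:
  assumes "continuous_on UNIV \<phi>" "strict_mono \<phi>" "\<phi> 0 = 0" "\<phi> 1 = 1" "\<And>x. 0 \<le> \<eta> x"
  shows "raise \<phi> \<eta> ` {z. Re z \<in> {0..1} \<and> Im z \<in> {0..1}} =
    {z. Re z \<in> {0..1} \<and> 0 \<le> Im z \<and> Im z \<le> 1 + \<eta> (Re z)}" (is "_ ` ?S = ?R")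
proof -
  have bounds: "\<phi> x \<in> {0..1}" if "x \<in> {0..1}" for x
    using that assms(2-4) by (metis atLeastAtMost_iff strict_mono_less_eq)
  have "raise \<phi> \<eta> z \<in> ?R" if z: "z \<in> ?S" for z
  proof -
    have "\<eta> (\<phi> (Re z)) * max 0 (min 1 (2 * Im z)) \<le> \<eta> (\<phi> (Re z)) * 1"
      using assms(5) by (intro mult_left_mono) auto
    then show ?thesis using z bounds[of "Re z"] assms(5) by (auto simp: raise_def)
  qed
  moreover have "z \<in> raise \<phi> \<eta> ` ?S" if z: "z \<in> ?R" for z
  proof -
    obtain x where x: "0 \<le> x" "x \<le> 1" "\<phi> x = Re z"
      using surj_interval[of \<phi> 0 "Re z" 1] assms z by auto
    define f where "f y = y + \<eta> (Re z) * max 0 (min 1 (2 * y))" for y :: real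
    have "continuous_on UNIV f" unfolding f_def by (intro continuous_intros)
    moreover have "f 0 \<le> Im z" "Im z \<le> f 1" using z by (auto simp: f_def)
    ultimately obtain y where "0 \<le> y" "y \<le> 1" "f y = Im z"
      using surj_interval[of f 0 "Im z" 1] by auto
    then have "z = raise \<phi> \<eta> (Complex x y)" "Complex x y \<in> ?S"
      using x by (simp_all add: raise_def f_def complex_eq_iff)
    then show ?thesis by (rule image_eqI)
  qed
  ultimately show ?thesis by blast
qed

text \<open>
  The coefficient is chosen such that the centre of the unit square moves to abscissa \<open>x0\<close>.
\<close>

definition slide :: "real \<Rightarrow> complex \<Rightarrow> complex" where
  "slide x0 z =
     Complex (Re z + (36 * x0 - 18) * tent (1/6) (1/2) (Im z) * tent (1/6) (1/2) (Re z)) (Im z)"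

text \<open>Both tents equal \<open>1/6\<close> at the centre, so the displacement is
  \<open>(36 * x0 - 18) / 36 = x0 - 1/2\<close>.\<close>

lemma slide_centre: "slide x0 (Complex (1/2) (1/2)) = Complex x0 (1/2)"
  by (simp add: slide_def tent_def field_simps)

lemma slide_fixed: "Im z \<notin> {0<..<1} \<or> Re z \<notin> {0<..<1} \<Longrightarrow> slide x0 z = z"
  unfolding slide_def using tent_eq_0[of "1/6" "Im z" "1/2"] tent_eq_0[of "1/6" "Re z" "1/2"]
  by (auto simp: abs_if complex_eq_iff)

text \<open>The three factors are below 18, at most \<open>1/6\<close> (the peak) and equal to
  \<open>1/3\<close> (the slope), so their product is below one and \<open>slide\<close> is
  increasing on horizontal lines.\<close>

lemma slide_coefficient:
  assumes "0 < x0" "x0 < 1"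
  shows "\<bar>(36 * x0 - 18) * tent (1/6) (1/2) y\<bar> * (1/3) < 1"
proof -
  have "\<bar>(36 * x0 - 18) * tent (1/6) (1/2) y\<bar> \<le> \<bar>36 * x0 - 18\<bar> * (1/6)"
    unfolding abs_mult using tent_bounds[of "1/6" "1/2" y] by (intro mult_left_mono) auto
  also have "\<dots> < 3" using assms by (simp add: abs_if)
  finally show ?thesis by simp
qed

lemma plane_monotone_slide:
  assumes "0 < x0" "x0 < 1"
  shows "plane_monotone (slide x0)"
  unfolding slide_def
proof (rule plane_monotone_horizontal)
  show "continuous_on UNIV (\<lambda>z. Re z + (36 * x0 - 18) * tent (1/6) (1/2) (Im z) * tent (1/6) (1/2) (Re z))"
    unfolding tent_def by (intro continuous_intros) auto
  show "x + (36 * x0 - 18) * tent (1/6) (1/2) y * tent (1/6) (1/2) x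
      < x' + (36 * x0 - 18) * tent (1/6) (1/2) y * tent (1/6) (1/2) x'" if "x < x'" for x x' y :: real
    using tent_lipschitz[of "1/6" "1/2" x x'] slide_coefficient[OF assms, of y] that
    by (intro perturbed_identity_strict[where k = "1/3"]) auto
qed

lemma slide_square:
  assumes "0 < x0" "x0 < 1"
  shows "slide x0 ` {z. Re z \<in> {0..1} \<and> Im z \<in> {0..1}} = {z. Re z \<in> {0..1} \<and> Im z \<in> {0..1}}"
    (is "_ ` ?S = ?S")
proof -
  define f where "f y x = x + (36 * x0 - 18) * tent (1/6) (1/2) y * tent (1/6) (1/2) x" for x y
  have slide: "slide x0 z = Complex (f (Im z) (Re z)) (Im z)" for z
    by (simp add: slide_def f_def)
  have f01: "f y 0 = 0" "f y 1 = 1" for y by (simp_all add: f_def tent_def)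
  have mono: "f y x \<le> f y x'" if "x \<le> x'" for x x' y
  proof (cases "x = x'")
    case False
    then have "x < x'" using that by simp
    then have "f y x < f y x'"
      unfolding f_def using tent_lipschitz[of "1/6" "1/2" x x'] slide_coefficient[OF assms, of y]
      by (intro perturbed_identity_strict[where k = "1/3"]) auto
    then show ?thesis by simp
  qed simp
  have "slide x0 z \<in> ?S" if z: "z \<in> ?S" for z
  proof -
    have "f (Im z) 0 \<le> f (Im z) (Re z)" "f (Im z) (Re z) \<le> f (Im z) 1"
      using z by (auto intro: mono)
    then show ?thesis using z by (simp add: slide f01)
  qed
  moreover have "z \<in> slide x0 ` ?S" if z: "z \<in> ?S" for z
  proof -
    have "continuous_on UNIV (f (Im z))" unfolding f_def tent_def by (intro continuous_intros) auto
    then obtain x where x: "0 \<le> x" "x \<le> 1" "f (Im z) x = Re z"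
      using surj_interval[of "f (Im z)" 0 "Re z" 1] z by (auto simp: f01)
    have "z = slide x0 (Complex x (Im z))" "Complex x (Im z) \<in> ?S"
      using x z by (simp_all add: slide)
    then show ?thesis by (rule image_eqI)
  qed
  ultimately show ?thesis by blast
qed

section \<open>Rearrangement of the slots on the top side of the central cell\<close>

lemma slot_affine: "slot k i (y + x * (z - y)) = slot k i y + x * (slot k i z - slot k i y)"
proof -
  have "slot k i z - slot k i y = (z - y) / (2 * real k + 1)"
    by (simp add: slot_def flip: diff_divide_distrib)
  then show ?thesis by (simp add: slot_def add_divide_distrib)
qed

lemma slot_strict_mono: "x < y \<Longrightarrow> slot k i x < slot k i y"
  by (simp add: slot_def divide_strict_right_mono)

text \<open>Consecutive slots are separated by a gap as wide as a slot, whence \<open>y + 2\<close>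
  rather than \<open>y + 1\<close>.\<close>

lemma slot_less_slot: "i < j \<Longrightarrow> x < y + 2 \<Longrightarrow> slot k i x < slot k j y"
  by (auto simp: slot_def intro!: divide_strict_right_mono)

text \<open>The children of the absorbed child come first and the other children of the centre
  follow, so source and target slots appear in the same order from left to right. An increasing
  function can thus be affine on every slot, the gaps taking up the difference.\<close>

lemma slot_rearrangement:
  assumes "1 \<le> n" "n \<le> m"
  obtains \<phi> where "continuous_on UNIV \<phi>" "strict_mono \<phi>" "\<phi> 0 = 0" "\<phi> 1 = 1"
    "\<And>j x. j < n \<Longrightarrow> x \<in> {0..1} \<Longrightarrow> \<phi> (slot m j x) = slot (m - n + 1) 0 (slot n j x)"
    "\<And>j x. n \<le> j \<Longrightarrow> j < m \<Longrightarrow> x \<in> {0..1} \<Longrightarrow> \<phi> (slot m j x) = slot (m - n + 1) (Suc j - n) x"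
proof -
  define k where "k = m - n + 1"
  \<comment> \<open>\<open>T j\<close> is the affine target of slot \<open>j\<close>. It makes sense
    for \<open>j = m\<close> too, and \<open>T m 0 = slot k k 0 = 1\<close> closes the list of
    breakpoints at the right end of the unit interval.\<close>
  define T where "T j x = (if j < n then slot k 0 (slot n j x) else slot k (Suc j - n) x)" for j x
  have T_affine: "T j x = T j 0 + x * (T j 1 - T j 0)" for j x
  proof -
    have "slot l i x = slot l i 0 + x * (slot l i 1 - slot l i 0)" for l i
      using slot_affine[of l i 0 x 1] by simp
    from this[of n j] this[of k "Suc j - n"] show ?thesis
      using slot_affine[of k 0 "slot n j 0" x "slot n j 1"] by (simp add: T_def)
  qed
  have T_less: "T j 0 < T j 1" for j
    by (auto simp: T_def intro!: slot_strict_mono)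
  have T_Suc: "T j 1 < T (Suc j) 0" for j
  proof -
    consider "Suc j < n" | "Suc j = n" | "n \<le> j" by linarith
    then show ?thesis
    proof cases
      case 2
      have "slot n j 1 < 2" using 2 by (simp add: slot_def divide_simps)
      then show ?thesis using 2 by (auto simp: T_def intro!: slot_less_slot)
    qed (auto simp: T_def intro!: slot_strict_mono slot_less_slot)
  qed
  have T0: "0 < T 0 0"
    using assms by (auto simp: T_def slot_def k_def intro!: divide_pos_pos add_pos_nonneg)
  \<comment> \<open>After scaling by \<open>2 * m + 1\<close>, slot \<open>j\<close> is the interval
    from \<open>2 * j + 1\<close> to \<open>2 * j + 2\<close>, so the breakpoints are integers and
    the intervals starting at even integers are gaps.\<close>
  define c where "c i = (if i = 0 then 0 else if odd i then T (i div 2) 0 else T (i div 2 - 1) 1)" for i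
  have "strict_mono c"
  proof (subst strict_mono_Suc_iff, intro allI)
    fix i
    show "c i < c (Suc i)"
    proof (cases "even i")
      case True
      then obtain j where "i = 2 * j" by (rule evenE)
      then show ?thesis using T0 T_Suc[of "j - 1"] by (cases j) (simp_all add: c_def)
    next
      case False
      then obtain j where "i = 2 * j + 1" by (rule oddE)
      then show ?thesis using T_less[of j] by (simp add: c_def)
    qed
  qed
  then obtain \<psi> where \<psi>: "continuous_on UNIV \<psi>" "strict_mono \<psi>"
    "\<forall>j<2 * m + 1. \<forall>t\<in>{0..1}. \<psi> (real j + t) = c j + t * (c (Suc j) - c j)"
    "\<forall>s\<ge>real (2 * m + 1). \<psi> s = c (2 * m + 1) + (s - real (2 * m + 1))"
    using piecewise_linear_interpolation[of c "2 * m + 1"] by blast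
  define \<phi> where "\<phi> x = \<psi> ((2 * real m + 1) * x)" for x
  have slot: "\<phi> (slot m j x) = T j x" if "j < m" "x \<in> {0..1}" for j x
  proof -
    have "(2 * real m + 1) * slot m j x = real (2 * j + 1) + x"
      by (simp add: slot_def)
    then have "\<phi> (slot m j x) = c (2 * j + 1) + x * (c (2 * j + 2) - c (2 * j + 1))"
      using \<psi>(3)[rule_format, of "2 * j + 1" x] that by (simp add: \<phi>_def)
    then show ?thesis by (subst T_affine) (simp add: c_def)
  qed
  have "continuous_on UNIV \<phi>"
    unfolding \<phi>_def by (intro continuous_on_compose2[OF \<psi>(1)] continuous_intros) auto
  moreover have "strict_mono \<phi>"
    by (auto simp: \<phi>_def strict_mono_def intro!: strict_monoD[OF \<psi>(2)])
  moreover have "\<phi> 0 = 0"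
    using \<psi>(3)[rule_format, of 0 0] by (simp add: \<phi>_def c_def)
  moreover have "\<phi> 1 = 1"
  proof -
    have "\<phi> 1 = c (2 * m + 1)" using \<psi>(4) by (simp add: \<phi>_def)
    also have "\<dots> = slot k k 0" using assms by (simp add: c_def T_def k_def Suc_diff_le)
    finally show ?thesis by (simp add: slot_def)
  qed
  ultimately show ?thesis
    by (rule that) (use assms in \<open>auto simp: slot T_def k_def\<close>)
qed

text \<open>The map is \<open>slide\<close>, then \<open>raise\<close>, then the inverse of
  \<open>squeeze\<close>: the square and the merged region are compared through the region below the
  trapezoid. The last two clauses cover the entire strip above an arc and hence all descendants of a
  child.\<close>

lemma absorbing_map:
  assumes "1 \<le> n" "n \<le> m"
  obtains h where "continuous_on UNIV h" "inj h" "orientation_preserving_on UNIV h"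
    "h ` cell n m [] = cell n (m - n + 1) [] \<union> cell n (m - n + 1) [0]"
    "h (vertex_point n m []) = vertex_point n (m - n + 1) [0]"
    "\<And>j z. j < n \<Longrightarrow> Re z \<in> {0..1} \<Longrightarrow> 0 \<le> Im z \<Longrightarrow>
      h (lift m j z) = lift (m - n + 1) 0 (lift n j z)"
    "\<And>j z. n \<le> j \<Longrightarrow> j < m \<Longrightarrow> Re z \<in> {0..1} \<Longrightarrow> 0 \<le> Im z \<Longrightarrow>
      h (lift m j z) = lift (m - n + 1) (Suc j - n) z"
proof -
  define k where "k = m - n + 1"
  obtain \<phi> where \<phi>: "continuous_on UNIV \<phi>" "strict_mono \<phi>" "\<phi> 0 = 0" "\<phi> 1 = 1"
    "\<And>j x. j < n \<Longrightarrow> x \<in> {0..1} \<Longrightarrow> \<phi> (slot m j x) = slot k 0 (slot n j x)"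
    "\<And>j x. n \<le> j \<Longrightarrow> j < m \<Longrightarrow> x \<in> {0..1} \<Longrightarrow> \<phi> (slot m j x) = slot k (Suc j - n) x"
    using slot_rearrangement[OF assms] unfolding k_def by metis
  \<comment> \<open>The absorbed child occupies \<open>[a,b]\<close>, and \<open>\<epsilon>\<close>
    is the relative width of the gaps between its children. The choice
    \<open>3 * \<delta> = a * \<epsilon>\<close> makes the tents vanish on the columns of these
    children.\<close>
  define a where "a = 1 / (2 * real k + 1)"
  define b where "b = 2 * a"
  define \<epsilon> where "\<epsilon> = 1 / (2 * real n + 1)"
  define \<delta> where "\<delta> = a * \<epsilon> / 3"
  have k1: "1 \<le> k" by (simp add: k_def)
  then have a: "0 < a" "3 * a \<le> 1" by (simp_all add: a_def divide_simps)
  have \<epsilon>: "0 < \<epsilon>" "\<epsilon> \<le> 1/3" using assms(1) by (simp_all add: \<epsilon>_def divide_simps)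
  have "a * \<epsilon> \<le> a * (1/3)" using a \<epsilon> by (intro mult_left_mono) auto
  then have \<delta>: "0 < \<delta>" "9 * \<delta> \<le> a" using a \<epsilon> by (simp_all add: \<delta>_def)
  have slot0: "slot k 0 y = a + a * y" for y by (simp add: slot_def a_def divide_simps)
  have slot0_bounds: "a + 3 * \<delta> \<le> slot k 0 y \<and> slot k 0 y \<le> b - 3 * \<delta>"
    if "\<epsilon> \<le> y" "y \<le> 1 - \<epsilon>" for y
  proof -
    have "a * \<epsilon> \<le> a * y" "a * y \<le> a * (1 - \<epsilon>)"
      using that a by (auto intro!: mult_left_mono)
    then show ?thesis by (simp add: slot0 b_def \<delta>_def algebra_simps)
  qed
  have slot_ge: "b + 3 * \<delta> \<le> slot k (Suc j) x" if "0 \<le> x" for j x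
  proof -
    have "3 * a \<le> slot k (Suc j) x" using that by (simp add: slot_def a_def divide_right_mono)
    then show ?thesis using \<delta> by (simp add: b_def)
  qed
  have slot_n: "\<epsilon> \<le> slot n j x \<and> slot n j x \<le> 1 - \<epsilon>" if "j < n" "x \<in> {0..1}" for j x
  proof -
    have "1 - \<epsilon> = 2 * real n / (2 * real n + 1)" by (simp add: \<epsilon>_def field_simps)
    moreover have "real j + 1 \<le> real n" using that(1) by linarith
    ultimately show ?thesis
      using that(2) by (auto simp: \<epsilon>_def slot_def intro!: divide_right_mono)
  qed

  define \<eta> where "\<eta> = trapezoid a b \<delta>"
  have \<eta>_cont: "continuous_on UNIV \<eta>"
    unfolding \<eta>_def trapezoid_def using \<delta> by (intro continuous_intros) auto
  have \<eta>_nonneg: "0 \<le> \<eta> x" for x by (simp add: \<eta>_def trapezoid_def)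
  have \<eta>_1: "\<eta> x = 1" if "a + \<delta> \<le> x" "x \<le> b - \<delta>" for x
  proof -
    have "1 \<le> (x - a) / \<delta>" "1 \<le> (b - x) / \<delta>" using that \<delta> by (simp_all add: pos_le_divide_eq)
    then show ?thesis by (simp add: \<eta>_def trapezoid_def)
  qed
  have \<eta>_0: "\<eta> x = 0" if "b \<le> x" for x
  proof -
    have "(b - x) / \<delta> \<le> 0" using that \<delta> by (simp add: divide_nonpos_pos)
    then show ?thesis by (simp add: \<eta>_def trapezoid_def)
  qed

  \<comment> \<open>The central puncture must land on the vertex of the absorbed child.
    \<open>raise\<close> gives it the right height \<open>3/2\<close>, while the right abscissa
    requires starting from a preimage \<open>x0\<close> under \<open>\<phi>\<close>;
    \<open>slide\<close> moves the puncture there.\<close>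
  have half: "a + 3 * \<delta> \<le> slot k 0 (1/2)" "slot k 0 (1/2) \<le> b - 3 * \<delta>"
    using slot0_bounds[of "1/2"] \<epsilon> by auto
  obtain x0 where x0: "0 \<le> x0" "x0 \<le> 1" "\<phi> x0 = slot k 0 (1/2)"
    using surj_interval[OF \<phi>(1), of 0 "slot k 0 (1/2)" 1] half a \<delta> \<phi>(3,4) by (auto simp: b_def)
  have "x0 \<noteq> 0" "x0 \<noteq> 1" using x0(3) half a \<delta> \<phi>(3,4) by (auto simp: b_def)
  then have x01: "0 < x0" "x0 < 1" using x0 by auto

  define L where "L = squeeze a b \<delta>"
  define K where "K = inv_into UNIV L"
  define h where "h = K \<circ> (raise \<phi> \<eta> \<circ> slide x0)"
  have surjL: "surj L" using \<delta> by (simp add: L_def surj_squeeze)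
  have monoL: "plane_monotone L" by (simp add: L_def plane_monotone_squeeze)
  have KL: "K (L z) = z" for z
    unfolding K_def using plane_monotone_inj[OF monoL] by (rule inv_into_f_f) simp
  have monoK: "plane_monotone K" unfolding K_def by (rule plane_monotone_inverse[OF monoL surjL])
  have monoR: "plane_monotone (raise \<phi> \<eta>)"
    by (rule plane_monotone_raise[OF \<phi>(1,2) \<eta>_cont \<eta>_nonneg])
  have monoS: "plane_monotone (slide x0)" by (rule plane_monotone_slide[OF x01])
  note cont = monoK[unfolded plane_monotone_def, THEN conjunct1]
    monoR[unfolded plane_monotone_def, THEN conjunct1]
    monoS[unfolded plane_monotone_def, THEN conjunct1]
  note inj = plane_monotone_inj[OF monoK] plane_monotone_inj[OF monoR] plane_monotone_inj[OF monoS]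
  note orient = plane_monotone_orientation_preserving[of _ UNIV]
  have RS: "continuous_on UNIV (raise \<phi> \<eta> \<circ> slide x0)" "inj (raise \<phi> \<eta> \<circ> slide x0)"
    "orientation_preserving_on UNIV (raise \<phi> \<eta> \<circ> slide x0)"
    using continuous_on_compose[OF cont(3) continuous_on_subset[OF cont(2) subset_UNIV]]
      inj_compose[OF inj(2,3)]
      orientation_preserving_on_comp[OF cont(3) inj(3) subset_UNIV orient[OF monoS]
        cont(2) inj(2) orient[OF monoR]]
    by auto
  have K_fixed: "K z = z" if "3 * \<delta> \<le> \<bar>Re z - a\<bar>" "3 * \<delta> \<le> \<bar>Re z - b\<bar>" for z
    using KL[of z] squeeze_fixed[of z \<delta> a b] that by (simp add: L_def)

  have "continuous_on UNIV h"
    unfolding h_def by (intro continuous_on_compose[OF RS(1) continuous_on_subset[OF cont(1) subset_UNIV]])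
  moreover have "inj h" unfolding h_def using inj(1) RS(2) by (rule inj_compose)
  moreover have "orientation_preserving_on UNIV h"
    unfolding h_def
    by (rule orientation_preserving_on_comp[OF RS(1,2) subset_UNIV RS(3) cont(1) inj(1) orient[OF monoK]])
  moreover have "h ` cell n m [] = cell n k [] \<union> cell n k [0]"
  proof -
    let ?S = "{z. Re z \<in> {0..1} \<and> Im z \<in> {0..1}}"
    have S: "cell n l [] = ?S" for l by (simp add: cell_def image_def)
    have "slot k 0 ` {0..1} = (\<lambda>x. a * x + a) ` {0..1}" by (simp add: slot0 add.commute)
    also have "\<dots> = {a..b}"
      using a image_affinity_atLeastAtMost[of a a 0 1] by (simp add: b_def)
    finally have C: "cell n k [0] = {z. Re z \<in> {a..b} \<and> Im z \<in> {1..2}}"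
      by (simp add: cell_def)
    have "h ` cell n m [] = K ` raise \<phi> \<eta> ` slide x0 ` ?S"
      unfolding S h_def by (simp only: image_comp comp_assoc)
    also have "\<dots> = K ` L ` (?S \<union> {z. Re z \<in> {a..b} \<and> Im z \<in> {1..2}})"
      unfolding slide_square[OF x01] raise_square[OF \<phi>(1-4) \<eta>_nonneg] L_def
      using \<delta> a by (subst squeeze_square_with_column) (auto simp: b_def \<eta>_def)
    also have "\<dots> = ?S \<union> {z. Re z \<in> {a..b} \<and> Im z \<in> {1..2}}"
      by (simp only: image_image KL image_ident)
    finally show ?thesis unfolding S C .
  qed
  moreover have "h (vertex_point n m []) = vertex_point n k [0]"
  proof -
    have "slide x0 (vertex_point n m []) = Complex x0 (1/2)"
      using slide_centre by (simp add: vertex_point_def)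
    moreover have "raise \<phi> \<eta> (Complex x0 (1/2)) = Complex (slot k 0 (1/2)) (3/2)"
      using half \<delta> by (simp add: raise_def x0(3) \<eta>_1)
    moreover have "K (Complex (slot k 0 (1/2)) (3/2)) = Complex (slot k 0 (1/2)) (3/2)"
      using half \<delta> by (intro K_fixed) auto
    ultimately show ?thesis by (simp add: h_def vertex_point_def)
  qed
  moreover have "h (lift m j z) = lift k 0 (lift n j z)"
    if j: "j < n" "Re z \<in> {0..1}" "0 \<le> Im z" for j z
  proof -
    have "slide x0 (lift m j z) = lift m j z"
      using j by (intro slide_fixed) (auto simp: lift_def)
    moreover have bounds: "a + 3 * \<delta> \<le> slot k 0 (slot n j (Re z))" "slot k 0 (slot n j (Re z)) \<le> b - 3 * \<delta>"
      using slot0_bounds[of "slot n j (Re z)"] slot_n[OF j(1,2)] by auto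
    have "raise \<phi> \<eta> (lift m j z) = lift k 0 (lift n j z)"
      using bounds \<delta> j \<phi>(5)[OF j(1,2)] by (simp add: raise_def lift_def \<eta>_1)
    moreover have "K (lift k 0 (lift n j z)) = lift k 0 (lift n j z)"
      using bounds \<delta> by (intro K_fixed) (auto simp: lift_def)
    ultimately show ?thesis by (simp add: h_def)
  qed
  moreover have "h (lift m j z) = lift k (Suc j - n) z"
    if j: "n \<le> j" "j < m" "Re z \<in> {0..1}" "0 \<le> Im z" for j z
  proof -
    have "slide x0 (lift m j z) = lift m j z"
      using j by (intro slide_fixed) (auto simp: lift_def)
    moreover have bounds: "b + 3 * \<delta> \<le> slot k (Suc j - n) (Re z)"
      using slot_ge[of "Re z" "j - n"] j by (simp add: Suc_diff_le)
    have "raise \<phi> \<eta> (lift m j z) = lift k (Suc j - n) z"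
      using bounds \<delta> \<phi>(6)[OF j(1-3)] by (simp add: raise_def lift_def \<eta>_0)
    moreover have "K (lift k (Suc j - n) z) = lift k (Suc j - n) z"
      using bounds \<delta> a by (intro K_fixed) (auto simp: lift_def b_def)
    ultimately show ?thesis by (simp add: h_def)
  qed
  ultimately show ?thesis unfolding k_def by (rule that)
qed

section \<open>Restriction of the plane map to the punctured surfaces\<close>

lemma vertex_point_Cons: "vertex_point n m (i # w) = lift m i (vertex_point n n w)"
  by (simp add: vertex_point_def lift_def)

lemma polygon_eq:
  assumes "Q \<subseteq> tree_vertices n m" "v \<in> tree_vertices n m"
  shows "polygon n m Q v = (if v \<in> Q then cell n m v - {vertex_point n m v} else cell n m v)"
  using assms vertex_point_in_cell_iff[of _ n m v] by (auto simp: polygon_def)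

lemma cell_bounds:
  assumes "v \<in> tree_vertices n m" "z \<in> cell n m v"
  shows "Re z \<in> {0..1}" "0 \<le> Im z"
proof -
  obtain x where "x \<in> {0..1}" "Re z = place n m v x" using assms(2) by (auto simp: cell_def)
  then show "Re z \<in> {0..1}" using place_bounds[OF assms(1), of x] by simp
  show "0 \<le> Im z" using assms(2) by (auto simp: cell_def)
qed

text \<open>Above each child of the root sits a compressed copy of the drawing in which the root
  also has \<open>n\<close> children. The clauses of \<open>absorbing_map\<close> about
  \<open>lift\<close> thereby apply to whole polygons.\<close>

lemma punctured_polygon_Cons:
  assumes "Q \<subseteq> tree_vertices n m" "i # w \<in> Q"
  shows "polygon n m Q (i # w) = lift m i ` (cell n n w - {vertex_point n n w})"
  using assms polygon_eq[of Q n m "i # w"]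
  by (auto simp: cell_Cons vertex_point_Cons image_set_diff[OF inj_lift])

text \<open>The exceptional sets are \<open>{[]}\<close> and \<open>{[], [0]}\<close>; that they
  differ in size is exactly what \<open>almost_rigid\<close> permits.\<close>

lemma rigid_homeos_absorbing:
  assumes "1 \<le> n" "n \<le> m"
  shows "\<exists>h. h \<in> rigid_homeos n m (tree_vertices n m) n (m - n + 1) (tree_vertices n (m - n + 1) - {[]})"
proof -
  define k where "k = m - n + 1"
  define V where "V = tree_vertices n m"
  define W where "W = tree_vertices n k"
  define P where "P = polygon n m V"
  define R where "R = polygon n k (W - {[]})"
  obtain h where h: "continuous_on UNIV h" "inj h" "orientation_preserving_on UNIV h"
    and h_root: "h ` cell n m [] = cell n k [] \<union> cell n k [0]"
      "h (vertex_point n m []) = vertex_point n k [0]"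
    and h_absorbed: "\<And>j z. j < n \<Longrightarrow> Re z \<in> {0..1} \<Longrightarrow> 0 \<le> Im z \<Longrightarrow>
      h (lift m j z) = lift k 0 (lift n j z)"
    and h_other: "\<And>j z. n \<le> j \<Longrightarrow> j < m \<Longrightarrow> Re z \<in> {0..1} \<Longrightarrow> 0 \<le> Im z \<Longrightarrow>
      h (lift m j z) = lift k (Suc j - n) z"
    using absorbing_map[OF assms] unfolding k_def by metis
  have k: "0 < k" by (simp add: k_def)
  have V: "[] \<in> V" by (simp add: V_def)
  have W: "[] \<in> W" "[0] \<in> W" using k by (simp_all add: W_def)
  \<comment> \<open>A first letter \<open>i < n\<close> names a child of the absorbed child, giving
    \<open>0 # i # w\<close>. Otherwise \<open>Suc i - n\<close> is positive, so the first letter of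
    the image tells the cases apart, as \<open>\<tau>\<close> does.\<close>
  define \<sigma> where "\<sigma> v = (if hd v < n then 0 # v else (Suc (hd v) - n) # tl v)" for v :: "nat list"
  define \<tau> where "\<tau> v = (if hd v = 0 then tl v else (hd v + n - 1) # tl v)" for v :: "nat list"

  have "h ` \<Union>(P ` {[]}) = \<Union>(R ` {[], [0]})"
  proof -
    have "P [] = cell n m [] - {vertex_point n m []}"
      using V polygon_eq[of V n m "[]"] by (simp add: P_def V_def)
    then have "h ` P [] = (cell n k [] \<union> cell n k [0]) - {vertex_point n k [0]}"
      using h_root by (simp add: image_set_diff[OF h(2)])
    \<comment> \<open>Removing the puncture therefore affects the second cell only, and the central
      polygon remains whole.\<close>
    moreover have "vertex_point n k [0] \<notin> cell n k []"
      using W vertex_point_in_cell_iff[of "[0]" n k "[]"] by (simp add: W_def)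
    moreover have "R [] = cell n k []" "R [0] = cell n k [0] - {vertex_point n k [0]}"
      using W polygon_eq[of "W - {[]}" n k] by (simp_all add: R_def W_def)
    ultimately show ?thesis by auto
  qed
  moreover have "bij_betw \<sigma> (V - {[]}) (W - {[], [0]})"
  proof (rule bij_betw_byWitness)
    show "\<forall>v\<in>V - {[]}. \<tau> (\<sigma> v) = v"
    proof
      fix v assume "v \<in> V - {[]}"
      then obtain i w where "v = i # w" by (cases v) auto
      then show "\<tau> (\<sigma> v) = v" by (simp add: \<sigma>_def \<tau>_def)
    qed
    show "\<forall>v\<in>W - {[], [0]}. \<sigma> (\<tau> v) = v"
    proof
      fix v assume v: "v \<in> W - {[], [0]}"
      then obtain i w where iw: "v = i # w" by (cases v) auto
      show "\<sigma> (\<tau> v) = v"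
      proof (cases i)
        case 0
        then obtain j u where "w = j # u" using v iw by (cases w) auto
        then show ?thesis using v iw 0 by (simp add: \<sigma>_def \<tau>_def W_def)
      next
        case (Suc i')
        then show ?thesis using iw by (simp add: \<sigma>_def \<tau>_def)
      qed
    qed
    show "\<sigma> ` (V - {[]}) \<subseteq> W - {[], [0]}"
    proof (rule image_subsetI)
      fix v assume v: "v \<in> V - {[]}"
      then obtain i w where "v = i # w" by (cases v) auto
      then show "\<sigma> v \<in> W - {[], [0]}"
        using v k assms by (auto simp: \<sigma>_def V_def W_def k_def)
    qed
    show "\<tau> ` (W - {[], [0]}) \<subseteq> V - {[]}"
    proof (rule image_subsetI)
      fix v assume v: "v \<in> W - {[], [0]}"
      then obtain i w where iw: "v = i # w" by (cases v) auto
      show "\<tau> v \<in> V - {[]}"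
      proof (cases i)
        case 0
        then obtain j u where "w = j # u" using v iw by (cases w) auto
        then show ?thesis using v iw 0 assms by (simp add: \<tau>_def V_def W_def)
      next
        case (Suc i')
        then show ?thesis using v iw assms by (auto simp: \<tau>_def V_def W_def k_def)
      qed
    qed
  qed
  moreover have "h ` P v = R (\<sigma> v)" if v: "v \<in> V - {[]}" for v
  proof -
    obtain i w where iw: "v = i # w" using v by (cases v) auto
    then have w: "w \<in> tree_vertices n n" and i: "i < m" using v by (simp_all add: V_def)
    have \<sigma>v: "\<sigma> v \<in> W - {[]}" using calculation(2) v by (auto simp: bij_betw_def)
    define C where "C = cell n n w - {vertex_point n n w}"
    have C: "Re z \<in> {0..1}" "0 \<le> Im z" if "z \<in> C" for z
      using that cell_bounds[OF w] by (auto simp: C_def)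
    have P: "P v = lift m i ` C"
      using v iw by (simp add: P_def C_def V_def punctured_polygon_Cons)
    show ?thesis
    proof (cases "i < n")
      case True
      have "polygon n n (tree_vertices n n) (i # w) = lift n i ` C"
        unfolding C_def using w True by (intro punctured_polygon_Cons) auto
      moreover have "polygon n n (tree_vertices n n) (i # w) = cell n n (i # w) - {vertex_point n n (i # w)}"
        using w True by (subst polygon_eq) auto
      moreover have "R (\<sigma> v) = lift k 0 ` (cell n n (i # w) - {vertex_point n n (i # w)})"
        using \<sigma>v iw True unfolding R_def \<sigma>_def by (simp, intro punctured_polygon_Cons) (auto simp: W_def)
      ultimately have "R (\<sigma> v) = lift k 0 ` lift n i ` C" by simp
      then show ?thesis
        unfolding P image_image using C h_absorbed[OF True] by (auto intro!: image_cong)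
    next
      case False
      then have "R (\<sigma> v) = lift k (Suc i - n) ` C"
        using \<sigma>v iw unfolding R_def \<sigma>_def C_def by (simp, intro punctured_polygon_Cons) (auto simp: W_def)
      then show ?thesis
        unfolding P image_image using C h_other[of i] False i by (auto intro!: image_cong)
    qed
  qed
  ultimately have "almost_rigid V P W R h"
    unfolding almost_rigid_def using V W
    by (intro exI[of _ "{[]}"] exI[of _ "{[], [0]}"] exI[of _ \<sigma>]) simp
  moreover from this have image: "h ` surface n m V = surface n k (W - {[]})"
    using almost_rigid_image[of V P W R h] unfolding P_def R_def V_def W_def Union_polygon by simp
  moreover have "homeomorphic_map (top_of_set (surface n m V)) (top_of_set (surface n k (W - {[]}))) h"
  proof -
    \<comment> \<open>Invariance of domain makes \<open>h\<close> a homeomorphism onto its image. It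
      restricts to the surface, whose image is already known from the matching of polygons.\<close>
    obtain g where "homeomorphism UNIV (h ` UNIV) h g"
      using invariance_of_domain_homeomorphism[of UNIV h] h(1,2) by auto
    then have "homeomorphism (surface n m V) (h ` surface n m V) h g"
      by (rule homeomorphism_of_subsets) auto
    then have "homeomorphic_maps (top_of_set (surface n m V)) (top_of_set (h ` surface n m V)) h g"
      unfolding homeomorphic_maps_def homeomorphism_def by force
    then show ?thesis unfolding image by (rule homeomorphic_maps_imp_map)
  qed
  moreover have "orientation_preserving_on (surface n m V) h"
    using h(3) by (rule orientation_preserving_on_subset) simp
  ultimately show ?thesis
    unfolding k_def[symmetric] V_def[symmetric] W_def[symmetric]
    by (auto simp: rigid_homeos_def P_def R_def V_def W_def)
qed

text \<open>The relation \<cong> between monoid records does not include the group axioms, so these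
  are asserted alongside it.\<close>

theorem lemma2p1:
  fixes m n :: nat
  assumes "m \<ge> 1" and "n \<ge> 1" and "m \<ge> n"
  shows "group (amod n m) \<and> group (amod_star n (m - n + 1)) \<and> amod n m \<cong> amod_star n (m - n + 1)"
  using rigid_homeos_absorbing[OF assms(2,3)] mapping_class_group_iso group_mapping_class_group
  unfolding amod_def amod_star_def by blast

end
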